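(* Let $M$ be a smooth manifold and $\Theta\in\Omega^n(M)$ be such that $\ker_1 d\Theta\neq\{0\}$ (at every point of $M$). Let $\mathbb{R}_\times=\mathbb{R}\setminus\{0\}$ with canonical coordinate $z$. Then the canonical (pre-)multisymplectization $(M\times\mathbb{R}_\times,\ \Omega:=-d(z\,\Theta))$ is a non-degenerate homogeneous multisymplectic manifold if and only if $$\ker_1\Theta\cap\ker_1 d\Theta=\{0\}.$$
   Context: $\ker_1\Theta=\{v\in TM:\iota_v\Theta=0\}$ and $\ker_1 d\Theta=\{v\in TM:\iota_v d\Theta=0\}$; the conditions on them are understood fibrewise, i.e. in $T_pM$ for every $p\in M$. On $M\times\mathbb{R}_\times$, $\Theta$ also denotes its pull-back under the projection to $M$. A closed $(n+1)$-form $\Omega$ on a manifold $\widetilde M$ is called pre-multisymplectic; it is multisymplectic (non-degenerate) if $v\mapsto\iota_v\Omega$, $T\widetilde M\to\bigwedge^n T^*\widetilde M$, is injective. A homogeneous (pre-)multisymplectic manifold is a pair $(\widetilde M,\Upsilon)$ with $\Upsilon\in\Omega^n(\widetilde M)$ such that $\Omega=-d\Upsilon$ is (pre-)multisymplectic and there is a vector field $\Delta$ (a Liouville vector field) with $\iota_\Delta\Omega=-\Upsilon$. Here $\Upsilon=z\,\Theta$ and one can take $\Delta=z\,\partial/\partial z$. *)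

theory Defs
  imports "HOL-Analysis.Analysis"
begin

section \<open>Smooth functions on open subsets of Euclidean spaces\<close>

text \<open>Only meant for open \<open>S\<close>; derivatives are taken in the full neighbourhood filter.\<close>

fun Ck_on :: "nat \<Rightarrow> 'a::euclidean_space set \<Rightarrow> ('a \<Rightarrow> 'b::real_normed_vector) \<Rightarrow> bool" where
  "Ck_on 0 S f \<longleftrightarrow> continuous_on S f"
| "Ck_on (Suc k) S f \<longleftrightarrow> (\<forall>x\<in>S. f differentiable (at x)) \<and>
     (\<forall>v. Ck_on k S (\<lambda>x. frechet_derivative f (at x) v))"

definition smooth_on :: "'a::euclidean_space set \<Rightarrow> ('a \<Rightarrow> 'b::real_normed_vector) \<Rightarrow> bool" where
  "smooth_on S f \<longleftrightarrow> (\<forall>k. Ck_on k S f)"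


section \<open>Smooth manifolds\<close>

text \<open>A chart is its domain together with the coordinate map, whose values outside the domain are
  irrelevant. The manifold carries any smooth atlas, not necessarily a maximal one. Its underlying
  set is \<open>topspace (mtop M)\<close> and its dimension is \<open>DIM('e)\<close>.\<close>

type_synonym ('a, 'e) chart = "'a set \<times> ('a \<Rightarrow> 'e)"

record ('a, 'e) mfd =
  mtop :: "'a topology"
  atlas :: "('a, 'e) chart set"

abbreviation points :: "('a, 'e) mfd \<Rightarrow> 'a set" where
  "points M \<equiv> topspace (mtop M)"

definition chart_inv :: "('a, 'e) chart \<Rightarrow> 'e \<Rightarrow> 'a" where
  "chart_inv c = inv_into (fst c) (snd c)"

definition transition :: "('a, 'e) chart \<Rightarrow> ('a, 'f) chart \<Rightarrow> 'e \<Rightarrow> 'f" where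
  "transition c c' = snd c' \<circ> chart_inv c"

definition smooth_manifold :: "('a, 'e::euclidean_space) mfd \<Rightarrow> bool" where
  "smooth_manifold M \<longleftrightarrow>
     Hausdorff_space (mtop M) \<and> second_countable (mtop M) \<and>
     (\<Union>c\<in>atlas M. fst c) = points M \<and>
     (\<forall>c\<in>atlas M. openin (mtop M) (fst c) \<and> open (snd c ` fst c) \<and>
        homeomorphic_map (subtopology (mtop M) (fst c)) (top_of_set (snd c ` fst c)) (snd c)) \<and>
     (\<forall>c\<in>atlas M. \<forall>c'\<in>atlas M. smooth_on (snd c ` (fst c \<inter> fst c')) (transition c c'))"

definition charts_at :: "('a, 'e) mfd \<Rightarrow> 'a \<Rightarrow> ('a, 'e) chart set" where
  "charts_at M p = {c \<in> atlas M. p \<in> fst c}"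

definition chart_at :: "('a, 'e) mfd \<Rightarrow> 'a \<Rightarrow> ('a, 'e) chart" where
  "chart_at M p = (SOME c. c \<in> charts_at M p)"


section \<open>Tangent vectors\<close>

text \<open>A tangent vector at \<open>p\<close> is the family of its coordinate vectors in all charts around \<open>p\<close>,
  which are related by the derivatives of the transition maps; the family is zero at all other
  charts, so that equality of tangent vectors is equality of functions.\<close>

type_synonym ('a, 'e) tvec = "('a, 'e) chart \<Rightarrow> 'e"

definition tangent_space :: "('a, 'e::euclidean_space) mfd \<Rightarrow> 'a \<Rightarrow> ('a, 'e) tvec set" where
  "tangent_space M p = {v. (\<forall>c. c \<notin> charts_at M p \<longrightarrow> v c = 0) \<and>
     (\<forall>c\<in>charts_at M p. \<forall>c'\<in>charts_at M p.
        v c' = frechet_derivative (transition c c') (at (snd c p)) (v c))}"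

definition tzero :: "('a, 'e::euclidean_space) tvec" where
  "tzero = (\<lambda>c. 0)"

definition tcomb ::
  "real \<Rightarrow> ('a, 'e::euclidean_space) tvec \<Rightarrow> real \<Rightarrow> ('a, 'e) tvec \<Rightarrow> ('a, 'e) tvec" where
  "tcomb a v b w = (\<lambda>c. a *\<^sub>R v c + b *\<^sub>R w c)"

text \<open>The tangent vector at \<open>p\<close> whose coordinate vector in the chart \<open>c\<close> around \<open>p\<close> is \<open>w\<close>.\<close>

definition tvec_of ::
  "('a, 'e::euclidean_space) mfd \<Rightarrow> ('a, 'e) chart \<Rightarrow> 'a \<Rightarrow> 'e \<Rightarrow> ('a, 'e) tvec" where
  "tvec_of M c p w = (\<lambda>c'. if c' \<in> charts_at M p
     then frechet_derivative (transition c c') (at (snd c p)) w else 0)"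

definition vector_field ::
  "('a, 'e::euclidean_space) mfd \<Rightarrow> ('a \<Rightarrow> ('a, 'e) tvec) \<Rightarrow> bool" where
  "vector_field M D \<longleftrightarrow> (\<forall>p\<in>points M. D p \<in> tangent_space M p) \<and>
     (\<forall>c\<in>atlas M. smooth_on (snd c ` fst c) (\<lambda>x. D (chart_inv c x) c))"

text \<open>The differential at \<open>p\<close> of a smooth map \<open>F\<close>; it does not depend on the chart around \<open>p\<close>
  used to compute it.\<close>

definition differential :: "('a, 'e::euclidean_space) mfd \<Rightarrow> ('b, 'f::euclidean_space) mfd \<Rightarrow>
    ('a \<Rightarrow> 'b) \<Rightarrow> 'a \<Rightarrow> ('a, 'e) tvec \<Rightarrow> ('b, 'f) tvec" where
  "differential M N F p v = (\<lambda>c'. if c' \<in> charts_at N (F p)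
     then frechet_derivative (snd c' \<circ> F \<circ> chart_inv (chart_at M p)) (at (snd (chart_at M p) p))
            (v (chart_at M p))
     else 0)"


section \<open>Differential forms\<close>

text \<open>An \<open>n\<close>-form takes a point and a list of \<open>n\<close> tangent vectors. It is required to vanish on all
  other arguments, so that forms are equal iff they are equal as functions. In particular, with
  the definitions below, the interior product of a 0-form is zero.\<close>

type_synonym ('a, 'e) form = "'a \<Rightarrow> ('a, 'e) tvec list \<Rightarrow> real"

definition local_form ::
  "('a, 'e::euclidean_space) mfd \<Rightarrow> ('a, 'e) form \<Rightarrow> ('a, 'e) chart \<Rightarrow> 'e \<Rightarrow> 'e list \<Rightarrow> real" where
  "local_form M \<omega> c x ws = \<omega> (chart_inv c x) (map (tvec_of M c (chart_inv c x)) ws)"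

definition diff_form ::
  "nat \<Rightarrow> ('a, 'e::euclidean_space) mfd \<Rightarrow> ('a, 'e) form \<Rightarrow> bool" where
  "diff_form n M \<omega> \<longleftrightarrow>
     (\<forall>p vs. \<not> (p \<in> points M \<and> length vs = n \<and> set vs \<subseteq> tangent_space M p) \<longrightarrow> \<omega> p vs = 0) \<and>
     (\<forall>p\<in>points M. \<forall>vs. length vs = n \<and> set vs \<subseteq> tangent_space M p \<longrightarrow>
        (\<forall>i<n. \<forall>v\<in>tangent_space M p. \<forall>w\<in>tangent_space M p. \<forall>a b.
            \<omega> p (vs[i := tcomb a v b w]) = a * \<omega> p (vs[i := v]) + b * \<omega> p (vs[i := w])) \<and>
        (\<forall>i<n. \<forall>j<n. i \<noteq> j \<and> vs ! i = vs ! j \<longrightarrow> \<omega> p vs = 0)) \<and>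
     (\<forall>c\<in>atlas M. \<forall>ws. length ws = n \<longrightarrow>
        smooth_on (snd c ` fst c) (\<lambda>x. local_form M \<omega> c x ws))"

definition int_prod :: "('a, 'e) tvec \<Rightarrow> (('a, 'e) tvec list \<Rightarrow> real) \<Rightarrow> ('a, 'e) tvec list \<Rightarrow> real"
  where "int_prod v \<alpha> = (\<lambda>vs. \<alpha> (v # vs))"

definition omit :: "nat \<Rightarrow> 'b list \<Rightarrow> 'b list" where
  "omit i xs = take i xs @ drop (Suc i) xs"

text \<open>In a chart,
  \<open>d\<omega>(v\<^sub>0, \<dots>, v\<^sub>n) = (\<Sum>i\<le>n. (-1)^i \<cdot> (D\<omega> v\<^sub>i)(v\<^sub>0, \<dots>, v\<^sub>n without v\<^sub>i))\<close>,
  where \<open>D\<omega> v\<^sub>i\<close> differentiates the coefficients of \<open>\<omega>\<close> in direction \<open>v\<^sub>i\<close> (no factor \<open>1/(n+1)\<close>, so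
  that \<open>d(f\<omega>) = df \<and> \<omega> + f d\<omega>\<close> for the wedge product with \<open>\<iota>\<^sub>v(df \<and> \<omega>) = df(v) \<omega> - df \<and> \<iota>\<^sub>v\<omega>\<close>).
  The value does not depend on the chart around \<open>p\<close>.\<close>

definition ext_deriv :: "('a, 'e::euclidean_space) mfd \<Rightarrow> ('a, 'e) form \<Rightarrow> ('a, 'e) form" where
  "ext_deriv M \<omega> p vs =
     (if p \<in> points M \<and> set vs \<subseteq> tangent_space M p then
        let c = chart_at M p in
        (\<Sum>i<length vs. (-1) ^ i *
           frechet_derivative (\<lambda>x. local_form M \<omega> c x (map (\<lambda>v. v c) (omit i vs)))
             (at (snd c p)) ((vs ! i) c))
      else 0)"

definition pullback :: "('a, 'e::euclidean_space) mfd \<Rightarrow> ('b, 'f::euclidean_space) mfd \<Rightarrow>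
    ('a \<Rightarrow> 'b) \<Rightarrow> ('b, 'f) form \<Rightarrow> ('a, 'e) form" where
  "pullback M N F \<omega> p vs =
     (if p \<in> points M \<and> set vs \<subseteq> tangent_space M p
      then \<omega> (F p) (map (differential M N F p) vs) else 0)"

definition form_zero :: "('a, 'e) form" where
  "form_zero = (\<lambda>p vs. 0)"

definition form_uminus :: "('a, 'e) form \<Rightarrow> ('a, 'e) form" where
  "form_uminus \<omega> = (\<lambda>p vs. - \<omega> p vs)"

definition form_scale :: "('a \<Rightarrow> real) \<Rightarrow> ('a, 'e) form \<Rightarrow> ('a, 'e) form" where
  "form_scale f \<omega> = (\<lambda>p vs. f p * \<omega> p vs)"

definition ker1 :: "('a, 'e::euclidean_space) mfd \<Rightarrow> ('a, 'e) form \<Rightarrow> 'a \<Rightarrow> ('a, 'e) tvec set" where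
  "ker1 M \<omega> p = {v \<in> tangent_space M p. int_prod v (\<omega> p) = (\<lambda>vs. 0)}"


section \<open>Homogeneous multisymplectic manifolds\<close>

definition pre_multisymplectic ::
  "nat \<Rightarrow> ('a, 'e::euclidean_space) mfd \<Rightarrow> ('a, 'e) form \<Rightarrow> bool" where
  "pre_multisymplectic n M \<Omega> \<longleftrightarrow>
     smooth_manifold M \<and> diff_form (Suc n) M \<Omega> \<and> ext_deriv M \<Omega> = form_zero"

definition multisymplectic ::
  "nat \<Rightarrow> ('a, 'e::euclidean_space) mfd \<Rightarrow> ('a, 'e) form \<Rightarrow> bool" where
  "multisymplectic n M \<Omega> \<longleftrightarrow> pre_multisymplectic n M \<Omega> \<and>
     (\<forall>p\<in>points M. inj_on (\<lambda>v. int_prod v (\<Omega> p)) (tangent_space M p))"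

definition homogeneous_multisymplectic ::
  "nat \<Rightarrow> ('a, 'e::euclidean_space) mfd \<Rightarrow> ('a, 'e) form \<Rightarrow> bool" where
  "homogeneous_multisymplectic n M \<Upsilon> \<longleftrightarrow>
     diff_form n M \<Upsilon> \<and> multisymplectic n M (form_uminus (ext_deriv M \<Upsilon>)) \<and>
     (\<exists>\<Delta>. vector_field M \<Delta> \<and>
        (\<lambda>p. int_prod (\<Delta> p) (form_uminus (ext_deriv M \<Upsilon>) p)) = form_uminus \<Upsilon>)"


section \<open>The canonical (pre-)multisymplectization\<close>

definition prod_mfd :: "('a, 'e) mfd \<Rightarrow> ('b, 'f) mfd \<Rightarrow> ('a \<times> 'b, 'e \<times> 'f) mfd" where
  "prod_mfd M N = \<lparr>mtop = prod_topology (mtop M) (mtop N),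
     atlas = {(fst c \<times> fst c', map_prod (snd c) (snd c')) |c c'. c \<in> atlas M \<and> c' \<in> atlas N}\<rparr>"

definition R_times :: "(real, real) mfd" where
  "R_times = \<lparr>mtop = top_of_set (UNIV - {0}), atlas = {(UNIV - {0}, \<lambda>z. z)}\<rparr>"

definition multisymplectization ::
  "('a, 'e::euclidean_space) mfd \<Rightarrow> ('a \<times> real, 'e \<times> real) mfd" where
  "multisymplectization M = prod_mfd M R_times"

text \<open>The form \<open>z \<Theta>\<close>, with \<open>\<Theta>\<close> pulled back along the projection to \<open>M\<close>.\<close>

definition canonical_potential ::
  "('a, 'e::euclidean_space) mfd \<Rightarrow> ('a, 'e) form \<Rightarrow> ('a \<times> real, 'e \<times> real) form" where
  "canonical_potential M \<Theta> = form_scale snd (pullback (multisymplectization M) M fst \<Theta>)"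

end

theory Submission
  imports Defs
begin

text \<open>
  Write \<open>\<Upsilon> = z \<Theta>\<close>. Then \<open>\<Omega> = - d\<Upsilon> = - (dz \<and> \<Theta> + z d\<Theta>)\<close> is closed because \<open>d\<^sup>2 = 0\<close>, and contracting it
  with \<open>\<Delta> = z \<partial>/\<partial>z\<close>, which is annihilated by \<open>\<Theta>\<close> and \<open>d\<Theta>\<close>, gives \<open>- z \<Theta> = - \<Upsilon>\<close>. So the
  only condition at stake is that no vector \<open>a + t \<partial>/\<partial>z\<close> other than zero is annihilated by
  \<open>\<Omega>\<close>, at every point \<open>(p, z)\<close>. This is a question of linear algebra
  (\<open>first_kernel_potential\<close>). Up to sign, the contraction is

  \<open>t \<Theta> - dz \<and> \<iota>\<^sub>a\<Theta> + z \<iota>\<^sub>a d\<Theta>\<close>.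

  If \<open>a\<close> lies in both kernels and \<open>t = 0\<close>, this vanishes, so non-degeneracy forces the kernels to
  meet in zero. Conversely, let it vanish. The part containing \<open>dz\<close> gives \<open>\<iota>\<^sub>a\<Theta> = 0\<close>, the rest
  \<open>t \<Theta> = - z \<iota>\<^sub>a d\<Theta>\<close>. If \<open>t\<close> were not zero, every vector in the kernel of \<open>d\<Theta>\<close> would be in the
  kernel of \<open>\<Theta>\<close>; as the kernel of \<open>d\<Theta>\<close> is not zero, this contradicts the condition on the
  kernels. Hence \<open>t = 0\<close>, then \<open>\<iota>\<^sub>a d\<Theta> = 0\<close>, and \<open>a\<close> is in both kernels, so \<open>a = 0\<close>.

  The larger part of the work is to know that \<open>d\<close> behaves as it should: that \<open>d\<omega>\<close> is a smooth
  alternating form, that it may be computed in any chart (\<open>ext_deriv_local\<close>), and that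
  \<open>d\<^sup>2 = 0\<close> (\<open>ext_deriv_ext_deriv\<close>). In coordinates \<open>d\<eta>\<close> is a signed sum over the positions of a
  list of vectors. Both the square of \<open>d\<close> and the second-derivative terms in a change of
  coordinates are sums of that kind over pairs of positions, whose terms cancel because second
  derivatives are symmetric.
\<close>

section \<open>Smooth functions and symmetry of second derivatives\<close>

lemma Ck_on_cong:
  assumes "open S" and "\<And>x. x \<in> S \<Longrightarrow> f x = g x"
  shows "Ck_on k S f \<longleftrightarrow> Ck_on k S g"
proof -
  have imp: "Ck_on k S g" if "Ck_on k S f" "\<And>x. x \<in> S \<Longrightarrow> f x = g x" for f g :: "'a \<Rightarrow> 'b"
    using that
  proof (induction k arbitrary: f g)
    case 0
    then show ?case by (auto cong: continuous_on_cong)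
  next
    case (Suc k)
    have diff: "f differentiable at x" if "x \<in> S" for x
      using Suc.prems that by auto
    have "g differentiable at x" if "x \<in> S" for x
      using diff[OF that] has_derivative_transform_within_open[OF _ \<open>open S\<close> that] Suc.prems(2)
      unfolding differentiable_def by blast
    moreover have "Ck_on k S (\<lambda>x. frechet_derivative g (at x) v)" for v
    proof (rule Suc.IH)
      show "Ck_on k S (\<lambda>x. frechet_derivative f (at x) v)"
        using Suc.prems by simp
      show "frechet_derivative f (at x) v = frechet_derivative g (at x) v" if "x \<in> S" for x
        using frechet_derivative_transform_within_open[OF diff[OF that] \<open>open S\<close> that]
          Suc.prems(2) by metis
    qed
    ultimately show ?case by simp
  qed
  show ?thesis using imp[of f g] imp[of g f] assms by metis
qed

lemma Ck_on_SucD: "Ck_on (Suc k) S f \<Longrightarrow> Ck_on k S f"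
proof (induction k arbitrary: f)
  case 0
  then show ?case
    by (simp add: differentiable_imp_continuous_on differentiable_on_def differentiable_at_withinI)
next
  case (Suc k)
  then show ?case by (metis Ck_on.simps(2))
qed

lemma Ck_on_SucI:
  assumes "open S" and "\<And>x. x \<in> S \<Longrightarrow> (f has_derivative f' x) (at x)"
    and "\<And>v. Ck_on k S (\<lambda>x. f' x v)"
  shows "Ck_on (Suc k) S f"
proof -
  have "f differentiable at x" if "x \<in> S" for x
    using assms(2)[OF that] differentiable_def by blast
  moreover have "Ck_on k S (\<lambda>x. frechet_derivative f (at x) v)" for v
  proof -
    have "f' x v = frechet_derivative f (at x) v" if "x \<in> S" for x
      using frechet_derivative_at[OF assms(2)[OF that]] by simp
    then have "Ck_on k S (\<lambda>x. f' x v) \<longleftrightarrow> Ck_on k S (\<lambda>x. frechet_derivative f (at x) v)"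
      by (rule Ck_on_cong[OF assms(1)])
    then show ?thesis using assms(3) by blast
  qed
  ultimately show ?thesis by simp
qed

lemma Ck_on_const: "Ck_on k S (\<lambda>x. c)"
  by (induction k arbitrary: c) auto

lemma frechet_derivative_bounded_linear:
  "bounded_linear L \<Longrightarrow> frechet_derivative L (at x) = L"
  using bounded_linear_imp_has_derivative frechet_derivative_at by metis

lemma Ck_on_bounded_linear: "bounded_linear L \<Longrightarrow> Ck_on k S L"
  by (cases k) (auto simp: frechet_derivative_bounded_linear Ck_on_const
      intro: linear_continuous_on bounded_linear_imp_differentiable)

lemma Ck_on_compose_linear_left:
  assumes "bounded_linear L" "open S" "Ck_on k S f"
  shows "Ck_on k S (\<lambda>x. L (f x))"
  using assms(3)
proof (induction k arbitrary: f)
  case 0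
  then show ?case
    using assms(1) by (auto intro: continuous_on_compose2[OF linear_continuous_on])
next
  case (Suc k)
  have D: "((\<lambda>x. L (f x)) has_derivative (\<lambda>v. L (frechet_derivative f (at x) v))) (at x)"
    if "x \<in> S" for x
    using Suc.prems that
    by (intro bounded_linear.has_derivative[OF assms(1)]) (simp flip: frechet_derivative_works)
  have "Ck_on k S (\<lambda>x. L (frechet_derivative f (at x) v))" for v
    using Suc by simp
  from Ck_on_SucI[OF assms(2), OF D this] show ?case .
qed

lemma Ck_on_compose_linear_right:
  assumes "bounded_linear L" "open T" "L ` T \<subseteq> S" "Ck_on k S f"
  shows "Ck_on k T (\<lambda>x. f (L x))"
  using assms(4)
proof (induction k arbitrary: f)
  case 0
  then show ?case
    using continuous_on_compose2[of S f T L] linear_continuous_on[OF assms(1)] assms(3) by simp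
next
  case (Suc k)
  have D: "((\<lambda>x. f (L x)) has_derivative (\<lambda>v. frechet_derivative f (at (L x)) (L v))) (at x)"
    if "x \<in> T" for x
    by (rule has_derivative_compose[OF bounded_linear_imp_has_derivative[OF assms(1)]])
      (use Suc.prems that assms(3) in \<open>auto simp flip: frechet_derivative_works\<close>)
  have "Ck_on k T (\<lambda>x. frechet_derivative f (at (L x)) (L v))" for v
    using Suc.IH[of "\<lambda>y. frechet_derivative f (at y) (L v)"] Suc.prems by simp
  from Ck_on_SucI[OF assms(2), OF D this] show ?case .
qed

lemma Ck_on_add:
  assumes "open S" "Ck_on k S f" "Ck_on k S g"
  shows "Ck_on k S (\<lambda>x. f x + g x)"
  using assms(2,3)
proof (induction k arbitrary: f g)
  case 0
  then show ?case by (auto intro: continuous_on_add)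
next
  case (Suc k)
  have D: "((\<lambda>x. f x + g x) has_derivative
      (\<lambda>v. frechet_derivative f (at x) v + frechet_derivative g (at x) v)) (at x)"
    if "x \<in> S" for x
    using Suc.prems that by (intro has_derivative_add) (simp_all flip: frechet_derivative_works)
  have "Ck_on k S (\<lambda>x. frechet_derivative f (at x) v + frechet_derivative g (at x) v)" for v
    using Suc by simp
  from Ck_on_SucI[OF assms(1), OF D this] show ?case .
qed

lemma Ck_on_mult:
  fixes f g :: "_ \<Rightarrow> real"
  assumes "open S" "Ck_on k S f" "Ck_on k S g"
  shows "Ck_on k S (\<lambda>x. f x * g x)"
  using assms(2,3)
proof (induction k arbitrary: f g)
  case 0
  then show ?case by (auto intro: continuous_on_mult)
next
  case (Suc k)
  have D: "((\<lambda>x. f x * g x) has_derivative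
      (\<lambda>v. f x * frechet_derivative g (at x) v + frechet_derivative f (at x) v * g x)) (at x)"
    if "x \<in> S" for x
    using Suc.prems that by (intro has_derivative_mult) (simp_all flip: frechet_derivative_works)
  have "Ck_on k S (\<lambda>x. f x * frechet_derivative g (at x) v + frechet_derivative f (at x) v * g x)"
    for v
    using Suc.prems Suc.prems[THEN Ck_on_SucD]
    by (intro Ck_on_add[OF assms(1)] Suc.IH) simp_all
  from Ck_on_SucI[OF assms(1), OF D this] show ?case .
qed

lemma smooth_on_cong:
  "open S \<Longrightarrow> (\<And>x. x \<in> S \<Longrightarrow> f x = g x) \<Longrightarrow> smooth_on S f \<longleftrightarrow> smooth_on S g"
  unfolding smooth_on_def using Ck_on_cong by blast

lemma smooth_on_const [simp]: "smooth_on S (\<lambda>x. c)"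
  by (simp add: smooth_on_def Ck_on_const)

lemma smooth_on_bounded_linear: "bounded_linear L \<Longrightarrow> smooth_on S L"
  by (simp add: smooth_on_def Ck_on_bounded_linear)

lemma smooth_on_compose_linear_left:
  "bounded_linear L \<Longrightarrow> open S \<Longrightarrow> smooth_on S f \<Longrightarrow> smooth_on S (\<lambda>x. L (f x))"
  by (simp add: smooth_on_def Ck_on_compose_linear_left)

lemma smooth_on_compose_linear_right:
  "bounded_linear L \<Longrightarrow> open T \<Longrightarrow> L ` T \<subseteq> S \<Longrightarrow> smooth_on S f \<Longrightarrow> smooth_on T (\<lambda>x. f (L x))"
  unfolding smooth_on_def using Ck_on_compose_linear_right by blast

lemma smooth_on_add:
  "open S \<Longrightarrow> smooth_on S f \<Longrightarrow> smooth_on S g \<Longrightarrow> smooth_on S (\<lambda>x. f x + g x)"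
  by (simp add: smooth_on_def Ck_on_add)

lemma smooth_on_mult:
  fixes f g :: "_ \<Rightarrow> real"
  shows "open S \<Longrightarrow> smooth_on S f \<Longrightarrow> smooth_on S g \<Longrightarrow> smooth_on S (\<lambda>x. f x * g x)"
  by (simp add: smooth_on_def Ck_on_mult)

lemma smooth_on_sum:
  "open S \<Longrightarrow> (\<And>i. i \<in> I \<Longrightarrow> smooth_on S (f i)) \<Longrightarrow> smooth_on S (\<lambda>x. \<Sum>i\<in>I. f i x)"
  by (induction I rule: infinite_finite_induct) (auto intro: smooth_on_add)

lemma smooth_on_Pair:
  assumes "open S" "smooth_on S f" "smooth_on S g"
  shows "smooth_on S (\<lambda>x. (f x, g x))"
proof -
  have "smooth_on S (\<lambda>x. (f x, 0) + (0, g x))"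
    using assms
    by (intro smooth_on_add smooth_on_compose_linear_left[of "\<lambda>a. (a, 0)"]
        smooth_on_compose_linear_left[of "\<lambda>b. (0, b)"] bounded_linear_Pair
        bounded_linear_ident bounded_linear_zero)
  then show ?thesis by simp
qed

lemma smooth_on_imp_differentiable: "smooth_on S f \<Longrightarrow> x \<in> S \<Longrightarrow> f differentiable at x"
  unfolding smooth_on_def by (metis Ck_on.simps(2))

lemma smooth_on_has_derivative:
  "smooth_on S f \<Longrightarrow> x \<in> S \<Longrightarrow> (f has_derivative frechet_derivative f (at x)) (at x)"
  using smooth_on_imp_differentiable frechet_derivative_works by blast

lemma smooth_on_frechet_derivative:
  "smooth_on S f \<Longrightarrow> smooth_on S (\<lambda>x. frechet_derivative f (at x) v)"
  unfolding smooth_on_def by (metis Ck_on.simps(2))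

lemma smooth_on_imp_continuous_on: "smooth_on S f \<Longrightarrow> continuous_on S f"
  unfolding smooth_on_def by (metis Ck_on.simps(1))

text \<open>The second difference of \<open>f\<close> over the parallelogram spanned by \<open>h v\<close> and \<open>h w\<close> is symmetric
  in \<open>v\<close> and \<open>w\<close>; the mean value theorem, once in each direction, turns it into a second
  derivative at a nearby point.\<close>

lemma second_difference_mean_value:
  fixes f :: "'a::euclidean_space \<Rightarrow> real"
  assumes "h > 0" and f: "smooth_on S f"
    and S: "\<And>s t. \<lbrakk>0 \<le> s; s \<le> h; 0 \<le> t; t \<le> h\<rbrakk> \<Longrightarrow> x + s *\<^sub>R v + t *\<^sub>R w \<in> S"
  obtains s t where "0 \<le> s" "s \<le> h" "0 \<le> t" "t \<le> h"
    "f (x + h *\<^sub>R v + h *\<^sub>R w) - f (x + h *\<^sub>R v) - f (x + h *\<^sub>R w) + f x =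
       h * (h * frechet_derivative (\<lambda>y. frechet_derivative f (at y) v) (at (x + s *\<^sub>R v + t *\<^sub>R w)) w)"
proof -
  define D where "D y = frechet_derivative f (at y)" for y
  have fD: "(f has_derivative D y) (at y)" if "y \<in> S" for y
    unfolding D_def using f that by (rule smooth_on_has_derivative)
  define g where "g s = f (x + s *\<^sub>R v + h *\<^sub>R w) - f (x + s *\<^sub>R v)" for s
  have S0: "x + s *\<^sub>R v \<in> S" if "0 \<le> s" "s \<le> h" for s
    using S[of s 0] that \<open>h > 0\<close> by simp
  have Dscale: "D y (c *\<^sub>R u) = c * D y u" if "y \<in> S" for y c u
    using linear_scale[OF has_derivative_linear[OF fD[OF that]]] by simp
  have "\<exists>s\<in>{0<..<h}. g h - g 0 = (D (x + s *\<^sub>R v + h *\<^sub>R w) ((h - 0) *\<^sub>R v) - D (x + s *\<^sub>R v) ((h - 0) *\<^sub>R v))"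
  proof (rule mvt_simple[OF \<open>h > 0\<close>])
    fix s assume s: "0 \<le> s" "s \<le> h"
    have "(g has_derivative (\<lambda>r. D (x + s *\<^sub>R v + h *\<^sub>R w) (r *\<^sub>R v) - D (x + s *\<^sub>R v) (r *\<^sub>R v))) (at s)"
      unfolding g_def
      by (rule has_derivative_diff; rule has_derivative_compose[OF _ fD])
        (use s S S0 \<open>h > 0\<close> in \<open>auto intro!: derivative_eq_intros\<close>)
    then show "(g has_derivative (\<lambda>r. D (x + s *\<^sub>R v + h *\<^sub>R w) (r *\<^sub>R v) - D (x + s *\<^sub>R v) (r *\<^sub>R v)))
        (at s within {0..h})"
      by (rule has_derivative_at_withinI)
  qed
  then obtain s where s: "0 \<le> s" "s \<le> h" and
    "g h - g 0 = D (x + s *\<^sub>R v + h *\<^sub>R w) (h *\<^sub>R v) - D (x + s *\<^sub>R v) (h *\<^sub>R v)"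
    by (metis diff_zero greaterThanLessThan_iff less_imp_le)
  then have gs: "g h - g 0 = h * (D (x + s *\<^sub>R v + h *\<^sub>R w) v - D (x + s *\<^sub>R v) v)"
    using S[of s h] S0[of s] \<open>h > 0\<close> by (simp add: Dscale right_diff_distrib)
  define E where "E y = frechet_derivative (\<lambda>y. D y v) (at y)" for y
  have DE: "((\<lambda>y. D y v) has_derivative E y) (at y)" if "y \<in> S" for y
    unfolding D_def E_def
    using smooth_on_frechet_derivative[OF f] that by (rule smooth_on_has_derivative)
  have Escale: "E y (c *\<^sub>R u) = c * E y u" if "y \<in> S" for y c u
    using linear_scale[OF has_derivative_linear[OF DE[OF that]]] by simp
  have "\<exists>t\<in>{0<..<h}. D (x + s *\<^sub>R v + h *\<^sub>R w) v - D (x + s *\<^sub>R v + 0 *\<^sub>R w) v =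
      E (x + s *\<^sub>R v + t *\<^sub>R w) ((h - 0) *\<^sub>R w)"
  proof (rule mvt_simple[OF \<open>h > 0\<close>])
    fix t assume t: "0 \<le> t" "t \<le> h"
    have "((\<lambda>t. D (x + s *\<^sub>R v + t *\<^sub>R w) v) has_derivative (\<lambda>r. E (x + s *\<^sub>R v + t *\<^sub>R w) (r *\<^sub>R w))) (at t)"
      by (rule has_derivative_compose[OF _ DE])
        (use s t S in \<open>auto intro!: derivative_eq_intros\<close>)
    then show "((\<lambda>t. D (x + s *\<^sub>R v + t *\<^sub>R w) v) has_derivative (\<lambda>r. E (x + s *\<^sub>R v + t *\<^sub>R w) (r *\<^sub>R w)))
        (at t within {0..h})"
      by (rule has_derivative_at_withinI)
  qed
  then obtain t where t: "0 \<le> t" "t \<le> h" and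
    "D (x + s *\<^sub>R v + h *\<^sub>R w) v - D (x + s *\<^sub>R v + 0 *\<^sub>R w) v =
      E (x + s *\<^sub>R v + t *\<^sub>R w) (h *\<^sub>R w)"
    by (metis diff_zero greaterThanLessThan_iff less_imp_le)
  then have Dt: "D (x + s *\<^sub>R v + h *\<^sub>R w) v - D (x + s *\<^sub>R v) v =
      h * E (x + s *\<^sub>R v + t *\<^sub>R w) w"
    using S[OF s t] by (simp add: Escale)
  have "f (x + h *\<^sub>R v + h *\<^sub>R w) - f (x + h *\<^sub>R v) - f (x + h *\<^sub>R w) + f x = g h - g 0"
    by (simp add: g_def)
  also have "\<dots> = h * (h * E (x + s *\<^sub>R v + t *\<^sub>R w) w)"
    using gs Dt by simp
  finally show ?thesis
    using that s t unfolding E_def D_def by blast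
qed

lemma second_derivative_symmetric_real:
  fixes f :: "'a::euclidean_space \<Rightarrow> real"
  assumes "open S" "x \<in> S" "smooth_on S f"
  shows "frechet_derivative (\<lambda>y. frechet_derivative f (at y) v) (at x) w =
    frechet_derivative (\<lambda>y. frechet_derivative f (at y) w) (at x) v"
proof (rule ccontr)
  define A where "A v w y = frechet_derivative (\<lambda>y. frechet_derivative f (at y) v) (at y) w" for v w y
  assume "\<not> ?thesis"
  then have "A v w x \<noteq> A w v x" by (simp add: A_def)
  define e where "e = \<bar>A v w x - A w v x\<bar> / 2"
  have "e > 0" using \<open>A v w x \<noteq> A w v x\<close> by (simp add: e_def)
  have "isCont (A v w) x" for v w
    unfolding A_def
    using smooth_on_imp_continuous_on[OF smooth_on_frechet_derivative[OF
          smooth_on_frechet_derivative[OF assms(3)]]] assms(1,2)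
    by (simp add: continuous_on_eq_continuous_at)
  then have "\<exists>d>0. \<forall>y. dist y x < d \<longrightarrow> dist (A v w y) (A v w x) < e" for v w
    using \<open>e > 0\<close> unfolding continuous_at_eps_delta by blast
  then obtain d1 d2 where d: "d1 > 0" "d2 > 0"
    "\<And>y. dist y x < d1 \<Longrightarrow> dist (A v w y) (A v w x) < e"
    "\<And>y. dist y x < d2 \<Longrightarrow> dist (A w v y) (A w v x) < e"
    by meson
  obtain d3 where d3: "d3 > 0" "ball x d3 \<subseteq> S"
    using assms(1,2) open_contains_ball by blast
  define d where "d = min d1 (min d2 d3)"
  \<comment> \<open>The side \<open>h\<close> is so small that both parallelograms lie in the ball of radius \<open>d\<close> around \<open>x\<close>.\<close>
  define h where "h = d / (2 * (norm v + norm w + 1))"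
  have "d > 0" using d d3 by (simp add: d_def)
  have pos: "norm v + norm w + 1 > 0" by (smt (verit) norm_ge_zero)
  then have "h > 0" using \<open>d > 0\<close> by (simp add: h_def)
  have h: "h * (norm v + norm w) < d"
  proof -
    have "h * (norm v + norm w) \<le> h * (norm v + norm w + 1)"
      using \<open>h > 0\<close> by simp
    also have "\<dots> = d / 2" using pos by (simp add: h_def field_simps)
    finally show ?thesis using \<open>d > 0\<close> by linarith
  qed
  have near: "dist (x + s *\<^sub>R a + t *\<^sub>R b) x < d"
    if "0 \<le> s" "s \<le> h" "0 \<le> t" "t \<le> h" "norm a + norm b = norm v + norm w" for s t a b
  proof -
    have "norm (s *\<^sub>R a + t *\<^sub>R b) \<le> s * norm a + t * norm b"
      using that norm_triangle_ineq[of "s *\<^sub>R a" "t *\<^sub>R b"] by simp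
    also have "\<dots> \<le> h * norm a + h * norm b"
      using that by (intro add_mono mult_right_mono) auto
    also have "\<dots> < d" using h that(5) by (simp flip: distrib_left)
    finally show ?thesis by (simp add: dist_norm add.assoc)
  qed
  have inS: "x + s *\<^sub>R a + t *\<^sub>R b \<in> S"
    if "0 \<le> s" "s \<le> h" "0 \<le> t" "t \<le> h" "norm a + norm b = norm v + norm w" for s t a b
    using near[OF that] d3 by (auto simp: d_def dist_commute)
  obtain s t where st: "0 \<le> s" "s \<le> h" "0 \<le> t" "t \<le> h"
    "f (x + h *\<^sub>R v + h *\<^sub>R w) - f (x + h *\<^sub>R v) - f (x + h *\<^sub>R w) + f x =
      h * (h * A v w (x + s *\<^sub>R v + t *\<^sub>R w))"
    unfolding A_def
    by (rule second_difference_mean_value[OF \<open>h > 0\<close> assms(3), of x v w]) (use inS in auto)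
  obtain s' t' where st': "0 \<le> s'" "s' \<le> h" "0 \<le> t'" "t' \<le> h"
    "f (x + h *\<^sub>R w + h *\<^sub>R v) - f (x + h *\<^sub>R w) - f (x + h *\<^sub>R v) + f x =
      h * (h * A w v (x + s' *\<^sub>R w + t' *\<^sub>R v))"
    unfolding A_def
    by (rule second_difference_mean_value[OF \<open>h > 0\<close> assms(3), of x w v]) (use inS in auto)
  have "h * (h * A v w (x + s *\<^sub>R v + t *\<^sub>R w)) = h * (h * A w v (x + s' *\<^sub>R w + t' *\<^sub>R v))"
    using st(5) st'(5) by (simp add: algebra_simps)
  then have "A v w (x + s *\<^sub>R v + t *\<^sub>R w) = A w v (x + s' *\<^sub>R w + t' *\<^sub>R v)"
    using \<open>h > 0\<close> by simp
  moreover have "dist (A v w (x + s *\<^sub>R v + t *\<^sub>R w)) (A v w x) < e"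
    using near[OF st(1-4), of v w] by (intro d) (simp add: d_def)
  moreover have "dist (A w v (x + s' *\<^sub>R w + t' *\<^sub>R v)) (A w v x) < e"
    using near[OF st'(1-4), of w v] by (intro d) (simp add: d_def)
  ultimately show False
    unfolding e_def dist_real_def by (smt (verit) field_sum_of_halves)
qed

lemma second_derivative_symmetric:
  fixes f :: "'a::euclidean_space \<Rightarrow> 'b::euclidean_space"
  assumes "open S" "x \<in> S" "smooth_on S f"
  shows "frechet_derivative (\<lambda>y. frechet_derivative f (at y) v) (at x) w =
    frechet_derivative (\<lambda>y. frechet_derivative f (at y) w) (at x) v"
proof (rule euclidean_eqI)
  fix b :: 'b
  have comp: "frechet_derivative (\<lambda>y. g y \<bullet> b) (at y) v = frechet_derivative g (at y) v \<bullet> b"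
    if "smooth_on S g" "y \<in> S" for y v and g :: "'a \<Rightarrow> 'b"
    using frechet_derivative_at[OF has_derivative_inner_left[OF smooth_on_has_derivative[OF that]]]
    by metis
  have sm: "smooth_on S (\<lambda>y. f y \<bullet> b)"
    by (rule smooth_on_compose_linear_left[OF bounded_linear_inner_left assms(1,3)])
  have "frechet_derivative (\<lambda>y. frechet_derivative f (at y) v) (at x) w \<bullet> b =
      frechet_derivative (\<lambda>y. frechet_derivative (\<lambda>y. f y \<bullet> b) (at y) v) (at x) w" for v w
  proof -
    have "frechet_derivative (\<lambda>y. frechet_derivative f (at y) v) (at x) w \<bullet> b =
        frechet_derivative (\<lambda>y. frechet_derivative f (at y) v \<bullet> b) (at x) w"
      using comp[OF smooth_on_frechet_derivative[OF assms(3)] assms(2)] by simp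
    also have "\<dots> = frechet_derivative (\<lambda>y. frechet_derivative (\<lambda>y. f y \<bullet> b) (at y) v) (at x) w"
    proof (rule fun_cong[OF frechet_derivative_transform_within_open[OF _ assms(1,2)]])
      show "(\<lambda>y. frechet_derivative f (at y) v \<bullet> b) differentiable at x"
        by (rule smooth_on_imp_differentiable[OF smooth_on_compose_linear_left[OF
              bounded_linear_inner_left assms(1) smooth_on_frechet_derivative[OF assms(3)]] assms(2)])
    qed (simp add: comp[OF assms(3)])
    finally show ?thesis .
  qed
  then show "frechet_derivative (\<lambda>y. frechet_derivative f (at y) v) (at x) w \<bullet> b =
      frechet_derivative (\<lambda>y. frechet_derivative f (at y) w) (at x) v \<bullet> b"
    using second_derivative_symmetric_real[OF assms(1,2) sm, of v w] by simp
qed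

section \<open>Alternating multilinear functions on lists\<close>

definition alternating :: "nat \<Rightarrow> ('v::real_vector list \<Rightarrow> real) \<Rightarrow> bool" where
  "alternating n \<alpha> \<longleftrightarrow> (\<forall>vs. length vs \<noteq> n \<longrightarrow> \<alpha> vs = 0) \<and>
     (\<forall>xs ys. linear (\<lambda>v. \<alpha> (xs @ v # ys))) \<and>
     (\<forall>xs v ys zs. \<alpha> (xs @ v # ys @ v # zs) = 0)"

lemma alternating_length: "alternating n \<alpha> \<Longrightarrow> length vs \<noteq> n \<Longrightarrow> \<alpha> vs = 0"
  and alternating_linear: "alternating n \<alpha> \<Longrightarrow> linear (\<lambda>v. \<alpha> (xs @ v # ys))"
  and alternating_repeat: "alternating n \<alpha> \<Longrightarrow> \<alpha> (xs @ v # ys @ v # zs) = 0"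
  unfolding alternating_def by blast+

text \<open>Evaluate at \<open>v + w\<close> in both places and expand.\<close>

lemma alternating_swap:
  assumes "alternating n \<alpha>"
  shows "\<alpha> (xs @ v # w # ys) = - \<alpha> (xs @ w # v # ys)"
proof -
  note lin = alternating_linear[OF assms]
  have "\<alpha> (xs @ (v + w) # (v + w) # ys) =
      \<alpha> (xs @ v # v # ys) + \<alpha> (xs @ v # w # ys) + (\<alpha> (xs @ w # v # ys) + \<alpha> (xs @ w # w # ys))"
    using linear_add[OF lin, of xs v w "(v + w) # ys"]
      linear_add[OF lin, of "xs @ [v]" v w ys] linear_add[OF lin, of "xs @ [w]" v w ys] by simp
  then show ?thesis
    using alternating_repeat[OF assms, of xs _ "[]" ys] by simp
qed

lemma alternating_move:
  assumes "alternating n \<alpha>"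
  shows "\<alpha> (xs @ ys @ v # zs) = (-1) ^ length ys * \<alpha> (xs @ v # ys @ zs)"
proof (induction ys arbitrary: xs)
  case (Cons y ys)
  have "\<alpha> (xs @ (y # ys) @ v # zs) = (-1) ^ length ys * \<alpha> (xs @ y # v # ys @ zs)"
    using Cons[of "xs @ [y]"] by simp
  then show ?case using alternating_swap[OF assms, of xs y v] by simp
qed simp

lemma omit_Nil [simp]: "omit i [] = []"
  and omit_0 [simp]: "omit 0 (x # xs) = xs"
  and omit_Suc [simp]: "omit (Suc i) (x # xs) = x # omit i xs"
  by (simp_all add: omit_def)

lemma omit_map: "omit i (map f xs) = map f (omit i xs)"
  by (simp add: omit_def take_map drop_map)

lemma length_omit: "i < length xs \<Longrightarrow> length (omit i xs) = length xs - 1"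
  by (simp add: omit_def)

lemma omit_append_left: "i < length xs \<Longrightarrow> omit i (xs @ ys) = omit i xs @ ys"
  by (simp add: omit_def)

lemma omit_append_right: "omit (length xs + i) (xs @ ys) = xs @ omit i ys"
  by (simp add: omit_def)

lemma omit_omit: "i \<le> j \<Longrightarrow> omit j (omit i xs) = omit i (omit (Suc j) xs)"
proof (induction xs arbitrary: i j)
  case (Cons x xs)
  show ?case
  proof (cases i)
    case (Suc i')
    then obtain j' where "j = Suc j'" "i' \<le> j'" using Cons.prems by (cases j) auto
    then show ?thesis using Suc Cons.IH[of i' j'] by simp
  qed simp
qed simp

lemma nth_omit_ge: "i \<le> j \<Longrightarrow> Suc j < length xs \<Longrightarrow> omit i xs ! j = xs ! Suc j"
  by (simp add: omit_def nth_append)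

lemma nth_omit_less: "j < i \<Longrightarrow> i < length xs \<Longrightarrow> omit i xs ! j = xs ! j"
  by (simp add: omit_def nth_append)

lemma list_split_at_two:
  assumes "i \<le> j" "Suc j < length xs"
  obtains P Q R where "xs = P @ (xs ! i) # Q @ (xs ! Suc j) # R" "length P = i" "length Q = j - i"
proof -
  have "xs = take i xs @ xs ! i # drop (Suc i) xs"
    using assms by (simp add: id_take_nth_drop)
  moreover have "drop (Suc i) xs =
      take (j - i) (drop (Suc i) xs) @ drop (Suc i) xs ! (j - i) # drop (Suc (j - i)) (drop (Suc i) xs)"
    using assms by (intro id_take_nth_drop) simp
  moreover have "drop (Suc i) xs ! (j - i) = xs ! Suc j"
    using assms by simp
  ultimately have "xs = take i xs @ xs ! i # take (j - i) (drop (Suc i) xs) @ xs ! Suc j #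
      drop (Suc (j - i)) (drop (Suc i) xs)" by metis
  then show ?thesis
    by (rule that) (use assms in simp_all)
qed

text \<open>For \<open>\<beta> u vs = \<alpha> u * \<theta> vs\<close> this is the wedge product \<open>\<alpha> \<and> \<theta>\<close>, and for the derivative
  \<open>\<beta> u vs\<close> of the coefficient \<open>\<eta>\<^bsub>vs\<^esub>\<close> in direction \<open>u\<close> it is the exterior derivative \<open>d\<eta>\<close>.
  The two properties of \<open>d\<close> used below, \<open>d\<^sup>2 = 0\<close> and naturality, are vanishing statements for
  such sums, applied to second derivatives.\<close>

definition skew_sum :: "('v \<Rightarrow> 'v list \<Rightarrow> real) \<Rightarrow> 'v list \<Rightarrow> real" where
  "skew_sum \<beta> ws = (\<Sum>i<length ws. (-1) ^ i * \<beta> (ws ! i) (omit i ws))"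

lemma skew_sum_Cons:
  "skew_sum \<beta> (w # ws) = \<beta> w ws - skew_sum (\<lambda>u vs. \<beta> u (w # vs)) ws"
  unfolding skew_sum_def
  by (simp add: sum.lessThan_Suc_shift sum_negf del: sum.lessThan_Suc)

lemma skew_sum_add: "skew_sum (\<lambda>u vs. \<beta> u vs + \<gamma> u vs) ws = skew_sum \<beta> ws + skew_sum \<gamma> ws"
  by (simp add: skew_sum_def distrib_left sum.distrib)

lemma skew_sum_scale: "skew_sum (\<lambda>u vs. c * \<beta> u vs) ws = c * skew_sum \<beta> ws"
  by (simp add: skew_sum_def sum_distrib_left mult.left_commute)

lemma skew_sum_zero [simp]: "skew_sum (\<lambda>u vs. 0) ws = 0"
  by (simp add: skew_sum_def)

lemma skew_sum_map: "skew_sum \<beta> (map f ws) = skew_sum (\<lambda>u vs. \<beta> (f u) (map f vs)) ws"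
  by (simp add: skew_sum_def omit_map)

lemma skew_sum_append_Cons:
  "skew_sum \<beta> (xs @ v # ys) =
     (\<Sum>i<length xs. (-1) ^ i * \<beta> (xs ! i) (omit i xs @ v # ys)) + (-1) ^ length xs * \<beta> v (xs @ ys) +
     (\<Sum>i<length ys. (-1) ^ (Suc (length xs) + i) * \<beta> (ys ! i) (xs @ v # omit i ys))"
proof -
  define t where "t i = (-1) ^ i * \<beta> ((xs @ v # ys) ! i) (omit i (xs @ v # ys))" for i
  have split: "sum t {..<m + Suc k} = sum t {..<m} + t m + (\<Sum>i<k. t (Suc m + i))" for m k
    by (induction k) simp_all
  have "skew_sum \<beta> (xs @ v # ys) = sum t {..<length xs + Suc (length ys)}"
    by (simp add: skew_sum_def t_def)
  also have "\<dots> = sum t {..<length xs} + t (length xs) + (\<Sum>i<length ys. t (Suc (length xs) + i))"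
    by (rule split)
  also have "sum t {..<length xs} = (\<Sum>i<length xs. (-1) ^ i * \<beta> (xs ! i) (omit i xs @ v # ys))"
    by (intro sum.cong) (simp_all add: t_def nth_append omit_append_left)
  also have "t (length xs) = (-1) ^ length xs * \<beta> v (xs @ ys)"
    using omit_append_right[of xs 0 "v # ys"] by (simp add: t_def)
  also have "(\<Sum>i<length ys. t (Suc (length xs) + i)) =
      (\<Sum>i<length ys. (-1) ^ (Suc (length xs) + i) * \<beta> (ys ! i) (xs @ v # omit i ys))"
  proof (rule sum.cong[OF refl])
    show "t (Suc (length xs) + i) = (-1) ^ (Suc (length xs) + i) * \<beta> (ys ! i) (xs @ v # omit i ys)"
      for i
      using omit_append_right[of xs "Suc i" "v # ys"] by (simp add: t_def nth_append)
  qed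
  finally show ?thesis .
qed

text \<open>If \<open>v\<close> occurs twice, only the two terms that take it out survive; they differ by moving \<open>v\<close>
  past the entries in between, and the signs of the two positions make them cancel.\<close>

lemma alternating_skew_sum:
  assumes alt: "\<And>u. alternating n (\<beta> u)" and lin: "\<And>vs. linear (\<lambda>u. \<beta> u vs)"
  shows "alternating (Suc n) (skew_sum \<beta>)"
  unfolding alternating_def
proof (intro conjI allI impI)
  fix vs :: "'a list"
  assume "length vs \<noteq> Suc n"
  then show "skew_sum \<beta> vs = 0"
    unfolding skew_sum_def
    by (intro sum.neutral ballI) (auto simp: length_omit intro!: alternating_length[OF alt])
next
  fix xs ys :: "'a list"
  have "linear (\<lambda>v. \<beta> u (xs' @ v # ys'))" for u xs' ys'
    by (rule alternating_linear[OF alt])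
  then show "linear (\<lambda>v. skew_sum \<beta> (xs @ v # ys))"
    unfolding skew_sum_append_Cons
    by (intro linear_compose_add linear_compose_sum ballI
        linear_compose_scale_right[where 'b = real, unfolded real_scaleR_def] lin)
next
  fix xs ys zs :: "'a list" and v :: 'a
  have rep: "\<beta> u (as @ v # bs @ v # cs) = 0" for u as bs cs
    by (rule alternating_repeat[OF alt])
  have "skew_sum \<beta> (xs @ v # ys @ v # zs) = (-1) ^ length xs * \<beta> v (xs @ ys @ v # zs) +
      (\<Sum>i<length (ys @ v # zs).
        (-1) ^ (Suc (length xs) + i) * \<beta> ((ys @ v # zs) ! i) (xs @ v # omit i (ys @ v # zs)))"
    unfolding skew_sum_append_Cons by (simp add: rep)
  also have "(\<Sum>i<length (ys @ v # zs).
      (-1) ^ (Suc (length xs) + i) * \<beta> ((ys @ v # zs) ! i) (xs @ v # omit i (ys @ v # zs))) =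
      (-1) ^ Suc (length xs) * skew_sum (\<lambda>u vs. \<beta> u (xs @ v # vs)) (ys @ v # zs)"
    unfolding skew_sum_def sum_distrib_left by (simp add: power_add mult.assoc)
  also have "skew_sum (\<lambda>u vs. \<beta> u (xs @ v # vs)) (ys @ v # zs) =
      (-1) ^ length ys * \<beta> v (xs @ v # ys @ zs)"
    unfolding skew_sum_append_Cons using rep[of _ xs] by (simp add: rep)
  finally show "skew_sum \<beta> (xs @ v # ys @ v # zs) = 0"
    using alternating_move[OF alt, of v xs ys v zs] by simp
qed

text \<open>The pairs with \<open>i \<le> j\<close> are matched with the remaining ones by \<open>(i, j) \<mapsto> (j + 1, i)\<close>,
  since deleting the entry at \<open>i\<close> shifts the later positions by one.\<close>

lemma sum_antisymmetric_pairs: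
  fixes T :: "nat \<Rightarrow> nat \<Rightarrow> real"
  assumes "\<And>i j. i \<le> j \<Longrightarrow> j < N \<Longrightarrow> T (Suc j) i = - T i j"
  shows "(\<Sum>i<Suc N. \<Sum>j<N. T i j) = 0"
proof -
  have T: "T a b = - T b (a - 1)" if "b < a" "a < Suc N" for a b
    using assms[of b "a - 1"] that by simp
  let ?A = "{p \<in> {..<Suc N} \<times> {..<N}. fst p \<le> snd p}"
  let ?B = "{p \<in> {..<Suc N} \<times> {..<N}. \<not> fst p \<le> snd p}"
  have "(\<Sum>i<Suc N. \<Sum>j<N. T i j) = (\<Sum>p\<in>{..<Suc N} \<times> {..<N}. T (fst p) (snd p))"
    by (simp add: sum.cartesian_product split_beta)
  also have "\<dots> = (\<Sum>p\<in>?A. T (fst p) (snd p)) + (\<Sum>p\<in>?B. T (fst p) (snd p))"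
    by (subst sum.union_disjoint[symmetric]) (auto intro!: sum.cong)
  also have "(\<Sum>p\<in>?B. T (fst p) (snd p)) = (\<Sum>p\<in>?A. - T (fst p) (snd p))"
    by (rule sum.reindex_bij_witness[of _ "\<lambda>p. (Suc (snd p), fst p)" "\<lambda>p. (snd p, fst p - 1)"])
      (auto simp: T)
  finally show ?thesis by (simp add: sum_negf)
qed

text \<open>With second derivatives for \<open>\<gamma>\<close>, this is \<open>d\<^sup>2 = 0\<close>.\<close>

lemma skew_sum_iterated_symmetric:
  assumes sym: "\<And>u u' vs. \<gamma> u u' vs = \<gamma> u' u vs"
  shows "skew_sum (\<lambda>u. skew_sum (\<gamma> u)) ws = 0"
proof (cases ws)
  case (Cons w ws')
  define N where "N = length ws'"
  have len: "length ws = Suc N" using Cons N_def by simp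
  define T where "T i j = (-1) ^ i * ((-1) ^ j * \<gamma> (ws ! i) (omit i ws ! j) (omit j (omit i ws)))"
    for i j
  have "skew_sum (\<lambda>u. skew_sum (\<gamma> u)) ws = (\<Sum>i<Suc N. \<Sum>j<N. T i j)"
    unfolding skew_sum_def[of "\<lambda>u. skew_sum (\<gamma> u)"] len
    by (intro sum.cong refl) (simp add: skew_sum_def length_omit len T_def sum_distrib_left)
  also have "\<dots> = 0"
  proof (rule sum_antisymmetric_pairs)
    fix i j assume "i \<le> j" "j < N"
    then show "T (Suc j) i = - T i j"
      using len sym[of "ws ! i" "ws ! Suc j"]
      by (simp add: T_def omit_omit nth_omit_ge nth_omit_less)
  qed
  finally show ?thesis .
qed (simp add: skew_sum_def)

text \<open>In a change of coordinates, \<open>B\<close> is the second derivative of the transition map and \<open>L\<close> the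
  first: the Leibniz rule inserts \<open>B u v\<close> for each argument \<open>L v\<close> of the form. Exchanging \<open>u\<close> with
  \<open>v\<close> moves the inserted vector across the arguments in between.\<close>

lemma skew_sum_symmetric_insertion:
  assumes alt: "alternating n \<alpha>" and sym: "\<And>u v. B u v = B v u"
  shows "skew_sum (\<lambda>u vs. \<Sum>j<length vs. \<alpha> ((map L vs)[j := B u (vs ! j)])) ws = 0"
proof (cases ws)
  case (Cons w ws')
  define N where "N = length ws'"
  have len: "length ws = Suc N" using Cons N_def by simp
  define T where "T i j = (-1) ^ i * \<alpha> ((map L (omit i ws))[j := B (ws ! i) (omit i ws ! j)])" for i j
  have "skew_sum (\<lambda>u vs. \<Sum>j<length vs. \<alpha> ((map L vs)[j := B u (vs ! j)])) ws =
      (\<Sum>i<Suc N. \<Sum>j<N. T i j)"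
    unfolding skew_sum_def len
    by (intro sum.cong refl) (simp add: length_omit len T_def sum_distrib_left)
  also have "\<dots> = 0"
  proof (rule sum_antisymmetric_pairs)
    fix i j assume ij: "i \<le> j" "j < N"
    obtain P Q R a b where ws: "ws = P @ a # Q @ b # R"
      and lengths: "length P = i" "length Q = j - i"
      using list_split_at_two[of i j ws] ij len by (metis Suc_less_eq)
    have i: "i = length P" and j: "j = length P + length Q" using lengths ij by simp_all
    have o1: "omit i ws = P @ Q @ b # R"
      using omit_append_right[of P 0] by (simp add: ws i)
    have o2: "omit (Suc j) ws = P @ a # Q @ R"
      using omit_append_right[of "P @ a # Q" 0 "b # R"] by (simp add: ws j)
    have n1: "ws ! i = a" and n2: "ws ! Suc j = b"
      by (simp_all add: ws i j nth_append)
    have "T i j = (-1) ^ i * \<alpha> (map L P @ map L Q @ B a b # map L R)"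
      unfolding T_def o1 n1 by (simp add: i j nth_append list_update_append)
    moreover have "T (Suc j) i = (-1) ^ Suc j * \<alpha> (map L P @ B a b # map L Q @ map L R)"
      unfolding T_def o2 n2 using sym[of a b] by (simp add: i nth_append list_update_append)
    ultimately show "T (Suc j) i = - T i j"
      using alternating_move[OF alt, of "map L P" "map L Q" "B a b" "map L R"]
      by (simp add: i j power_add)
  qed
  finally show ?thesis .
qed (simp add: skew_sum_def)

section \<open>Differential forms on open subsets of Euclidean spaces\<close>

text \<open>Unlike \<open>diff_form\<close>, this imposes nothing outside \<open>S\<close>: the local representative of a form has
  arbitrary values outside the image of its chart.\<close>

definition form_on :: "nat \<Rightarrow> 'e::euclidean_space set \<Rightarrow> ('e \<Rightarrow> 'e list \<Rightarrow> real) \<Rightarrow> bool" where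
  "form_on n S \<eta> \<longleftrightarrow> open S \<and> (\<forall>x\<in>S. alternating n (\<eta> x)) \<and> (\<forall>ws. smooth_on S (\<lambda>x. \<eta> x ws))"

definition local_d :: "('e::euclidean_space \<Rightarrow> 'e list \<Rightarrow> real) \<Rightarrow> 'e \<Rightarrow> 'e list \<Rightarrow> real" where
  "local_d \<eta> x = skew_sum (\<lambda>u vs. frechet_derivative (\<lambda>y. \<eta> y vs) (at x) u)"

lemma frechet_derivative_cong:
  assumes "open S" "x \<in> S" "\<And>y. y \<in> S \<Longrightarrow> f y = g y"
  shows "frechet_derivative f (at x) = frechet_derivative g (at x)"
proof -
  have "(f has_derivative f') (at x) \<longleftrightarrow> (g has_derivative f') (at x)" for f'
    by (rule iffI; erule has_derivative_transform_within_open[OF _ assms(1,2)]) (simp_all add: assms(3))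
  then show ?thesis unfolding frechet_derivative_def by simp
qed

lemma form_on_has_derivative:
  assumes "form_on n S \<eta>" "x \<in> S"
  shows "((\<lambda>y. \<eta> y ws) has_derivative frechet_derivative (\<lambda>y. \<eta> y ws) (at x)) (at x)"
  using assms smooth_on_has_derivative unfolding form_on_def by blast

lemma form_on_linear_derivative:
  assumes "form_on n S \<eta>" "x \<in> S"
  shows "linear (frechet_derivative (\<lambda>y. \<eta> y ws) (at x))"
  using form_on_has_derivative[OF assms] has_derivative_linear by blast

text \<open>All identities that define an alternating form are linear in the coefficients and hold on
  an open set, so they pass to directional derivatives of the coefficients.\<close>

lemma alternating_derivative:
  assumes \<eta>: "form_on n S \<eta>" and x: "x \<in> S"
  shows "alternating n (\<lambda>ws. frechet_derivative (\<lambda>y. \<eta> y ws) (at x) u)"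
proof -
  have S: "open S" and alt: "\<And>y. y \<in> S \<Longrightarrow> alternating n (\<eta> y)"
    using \<eta> unfolding form_on_def by blast+
  have zero: "frechet_derivative (\<lambda>y. \<eta> y ws) (at x) u = 0" if "\<And>y. y \<in> S \<Longrightarrow> \<eta> y ws = 0" for ws
    using frechet_derivative_cong[OF S x, of "\<lambda>y. \<eta> y ws" "\<lambda>y. 0"] that by simp
  note D = form_on_has_derivative[OF \<eta> x]
  show ?thesis
    unfolding alternating_def
  proof (intro conjI allI impI)
    show "frechet_derivative (\<lambda>y. \<eta> y vs) (at x) u = 0" if "length vs \<noteq> n" for vs
      by (rule zero) (rule alternating_length[OF alt that])
    show "frechet_derivative (\<lambda>y. \<eta> y (xs @ v # ys @ v # zs)) (at x) u = 0" for xs v ys zs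
      by (rule zero) (rule alternating_repeat[OF alt])
    show "linear (\<lambda>v. frechet_derivative (\<lambda>y. \<eta> y (xs @ v # ys)) (at x) u)" for xs ys
    proof (rule linearI)
      fix v w :: 'a and c :: real
      have "frechet_derivative (\<lambda>y. \<eta> y (xs @ (v + w) # ys)) (at x) =
          frechet_derivative (\<lambda>y. \<eta> y (xs @ v # ys) + \<eta> y (xs @ w # ys)) (at x)"
        by (rule frechet_derivative_cong[OF S x]) (rule linear_add[OF alternating_linear[OF alt]])
      also have "\<dots> = (\<lambda>u. frechet_derivative (\<lambda>y. \<eta> y (xs @ v # ys)) (at x) u +
          frechet_derivative (\<lambda>y. \<eta> y (xs @ w # ys)) (at x) u)"
        by (rule frechet_derivative_at[symmetric]) (rule has_derivative_add[OF D D])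
      finally show "frechet_derivative (\<lambda>y. \<eta> y (xs @ (v + w) # ys)) (at x) u =
          frechet_derivative (\<lambda>y. \<eta> y (xs @ v # ys)) (at x) u +
          frechet_derivative (\<lambda>y. \<eta> y (xs @ w # ys)) (at x) u" by simp
      have "frechet_derivative (\<lambda>y. \<eta> y (xs @ (c *\<^sub>R v) # ys)) (at x) =
          frechet_derivative (\<lambda>y. c *\<^sub>R \<eta> y (xs @ v # ys)) (at x)"
        by (rule frechet_derivative_cong[OF S x]) (rule linear_scale[OF alternating_linear[OF alt]])
      also have "\<dots> = (\<lambda>u. c *\<^sub>R frechet_derivative (\<lambda>y. \<eta> y (xs @ v # ys)) (at x) u)"
        by (rule frechet_derivative_at[symmetric]) (rule has_derivative_scaleR_right[OF D])
      finally show "frechet_derivative (\<lambda>y. \<eta> y (xs @ (c *\<^sub>R v) # ys)) (at x) u =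
          c *\<^sub>R frechet_derivative (\<lambda>y. \<eta> y (xs @ v # ys)) (at x) u" by simp
    qed
  qed
qed

lemma form_on_local_d:
  assumes "form_on n S \<eta>"
  shows "form_on (Suc n) S (local_d \<eta>)"
proof -
  have S: "open S" and sm: "\<And>ws. smooth_on S (\<lambda>x. \<eta> x ws)"
    using assms unfolding form_on_def by blast+
  have "alternating (Suc n) (local_d \<eta> x)" if "x \<in> S" for x
    unfolding local_d_def
    using alternating_derivative[OF assms that] form_on_linear_derivative[OF assms that]
    by (rule alternating_skew_sum)
  moreover have "smooth_on S (\<lambda>x. local_d \<eta> x ws)" for ws
    unfolding local_d_def skew_sum_def
    by (intro smooth_on_sum smooth_on_mult smooth_on_const smooth_on_frechet_derivative sm S)
  ultimately show ?thesis using S unfolding form_on_def by blast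
qed

lemma local_d_local_d:
  assumes \<eta>: "form_on n S \<eta>" and x: "x \<in> S"
  shows "local_d (local_d \<eta>) x ws = 0"
proof -
  have S: "open S" and sm: "\<And>ws. smooth_on S (\<lambda>x. \<eta> x ws)"
    using \<eta> unfolding form_on_def by blast+
  have "frechet_derivative (\<lambda>y. local_d \<eta> y vs) (at x) =
      (\<lambda>u. skew_sum (\<lambda>u' vs'. frechet_derivative
        (\<lambda>y. frechet_derivative (\<lambda>y. \<eta> y vs') (at y) u') (at x) u) vs)" for vs
    unfolding local_d_def skew_sum_def
    by (rule frechet_derivative_at[symmetric])
      (intro has_derivative_sum has_derivative_mult_right
        smooth_on_has_derivative[OF smooth_on_frechet_derivative[OF sm] x])
  then have "local_d (local_d \<eta>) x ws = skew_sum (\<lambda>u. skew_sum (\<lambda>u' vs. frechet_derivative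
      (\<lambda>y. frechet_derivative (\<lambda>y. \<eta> y vs) (at y) u') (at x) u)) ws"
    by (simp add: local_d_def[of "local_d \<eta>"])
  also have "\<dots> = 0"
    by (rule skew_sum_iterated_symmetric) (rule second_derivative_symmetric[OF S x sm])
  finally show ?thesis .
qed

lemma linear_eq_sum_Basis:
  fixes f :: "'e::euclidean_space \<Rightarrow> real"
  assumes "linear f"
  shows "f v = (\<Sum>b\<in>Basis. (v \<bullet> b) * f b)"
proof -
  have "f v = f (\<Sum>b\<in>Basis. (v \<bullet> b) *\<^sub>R b)" by (simp add: euclidean_representation)
  also have "\<dots> = (\<Sum>b\<in>Basis. (v \<bullet> b) * f b)"
    using assms by (simp add: linear_sum linear_scale)
  finally show ?thesis .
qed

text \<open>The Leibniz rule for a form evaluated on variable vectors \<open>G w y\<close>, by induction on their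
  number: expanding the first of them in a basis makes it constant.\<close>

lemma has_derivative_form_variable_arguments:
  fixes \<phi> :: "'a::euclidean_space \<Rightarrow> 'e::euclidean_space" and G G' :: "'w \<Rightarrow> 'a \<Rightarrow> 'e"
  assumes \<eta>: "form_on n S \<eta>" and U: "open U" "x \<in> U" "\<phi> ` U \<subseteq> S"
    and \<phi>: "(\<phi> has_derivative \<phi>') (at x)" and G: "\<And>w. (G w has_derivative G' w) (at x)"
  shows "((\<lambda>y. \<eta> (\<phi> y) (us @ map (\<lambda>w. G w y) ws)) has_derivative
    (\<lambda>h. frechet_derivative (\<lambda>z. \<eta> z (us @ map (\<lambda>w. G w x) ws)) (at (\<phi> x)) (\<phi>' h) +
      (\<Sum>j<length ws. \<eta> (\<phi> x) (us @ (map (\<lambda>w. G w x) ws)[j := G' (ws ! j) h])))) (at x)"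
proof (induction ws arbitrary: us)
  case Nil
  show ?case
    using has_derivative_compose[OF \<phi> form_on_has_derivative[OF \<eta>, of "\<phi> x" us]] U by auto
next
  case (Cons w ws)
  have \<phi>S: "\<phi> y \<in> S" if "y \<in> U" for y using U that by blast
  define R where "R y = map (\<lambda>w. G w y) ws" for y
  define E where "E vs h = frechet_derivative (\<lambda>z. \<eta> z vs) (at (\<phi> x)) (\<phi>' h)" for vs h
  define Q where "Q h j = (R x)[j := G' (ws ! j) h]" for h j
  have lin: "linear (\<lambda>v. \<eta> (\<phi> y) (as @ v # bs))" if "y \<in> U" for y as bs
    using \<eta> \<phi>S[OF that] alternating_linear unfolding form_on_def by blast
  have linE: "linear (\<lambda>v. E (as @ v # bs) h)" for as bs h
    unfolding E_def by (rule alternating_linear[OF alternating_derivative[OF \<eta> \<phi>S[OF U(2)]]])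
  have IH: "((\<lambda>y. \<eta> (\<phi> y) (us @ b # R y)) has_derivative
      (\<lambda>h. E (us @ b # R x) h + (\<Sum>j<length ws. \<eta> (\<phi> x) (us @ b # Q h j)))) (at x)" for b
    using Cons[of "us @ [b]"] by (simp add: R_def E_def Q_def)
  have "((\<lambda>y. \<Sum>b\<in>Basis. (G w y \<bullet> b) * \<eta> (\<phi> y) (us @ b # R y)) has_derivative
      (\<lambda>h. \<Sum>b\<in>Basis. (G w x \<bullet> b) * (E (us @ b # R x) h +
        (\<Sum>j<length ws. \<eta> (\<phi> x) (us @ b # Q h j))) + (G' w h \<bullet> b) * \<eta> (\<phi> x) (us @ b # R x))) (at x)"
    by (intro has_derivative_sum has_derivative_mult IH has_derivative_inner_left G)
  also have "(\<lambda>h. \<Sum>b\<in>Basis. (G w x \<bullet> b) * (E (us @ b # R x) h +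
        (\<Sum>j<length ws. \<eta> (\<phi> x) (us @ b # Q h j))) + (G' w h \<bullet> b) * \<eta> (\<phi> x) (us @ b # R x)) =
      (\<lambda>h. E (us @ G w x # R x) h + ((\<Sum>j<length ws. \<eta> (\<phi> x) (us @ G w x # Q h j)) +
        \<eta> (\<phi> x) (us @ G' w h # R x)))"
  proof
    fix h
    have e1: "(\<Sum>b\<in>Basis. (G w x \<bullet> b) * E (us @ b # R x) h) = E (us @ G w x # R x) h"
      using linear_eq_sum_Basis[OF linE] by metis
    have e2: "(\<Sum>b\<in>Basis. \<Sum>j<length ws. (G w x \<bullet> b) * \<eta> (\<phi> x) (us @ b # Q h j)) =
        (\<Sum>j<length ws. \<eta> (\<phi> x) (us @ G w x # Q h j))"
      by (subst sum.swap) (rule sum.cong[OF refl], rule linear_eq_sum_Basis[OF lin[OF U(2)], symmetric])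
    have e3: "(\<Sum>b\<in>Basis. (G' w h \<bullet> b) * \<eta> (\<phi> x) (us @ b # R x)) = \<eta> (\<phi> x) (us @ G' w h # R x)"
      using linear_eq_sum_Basis[OF lin[OF U(2)]] by metis
    show "(\<Sum>b\<in>Basis. (G w x \<bullet> b) * (E (us @ b # R x) h +
        (\<Sum>j<length ws. \<eta> (\<phi> x) (us @ b # Q h j))) + (G' w h \<bullet> b) * \<eta> (\<phi> x) (us @ b # R x)) =
      E (us @ G w x # R x) h + ((\<Sum>j<length ws. \<eta> (\<phi> x) (us @ G w x # Q h j)) +
        \<eta> (\<phi> x) (us @ G' w h # R x))"
      by (simp add: sum.distrib distrib_left sum_distrib_left e1 e2 e3)
  qed
  finally have D: "((\<lambda>y. \<Sum>b\<in>Basis. (G w y \<bullet> b) * \<eta> (\<phi> y) (us @ b # R y)) has_derivative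
      (\<lambda>h. E (us @ G w x # R x) h + ((\<Sum>j<length ws. \<eta> (\<phi> x) (us @ G w x # Q h j)) +
        \<eta> (\<phi> x) (us @ G' w h # R x)))) (at x)" .
  have "((\<lambda>y. \<eta> (\<phi> y) (us @ G w y # R y)) has_derivative
      (\<lambda>h. E (us @ G w x # R x) h + ((\<Sum>j<length ws. \<eta> (\<phi> x) (us @ G w x # Q h j)) +
        \<eta> (\<phi> x) (us @ G' w h # R x)))) (at x)"
    by (rule has_derivative_transform_within_open[OF D U(1,2)])
      (rule linear_eq_sum_Basis[OF lin, symmetric])
  then show ?case
    by (simp add: R_def E_def Q_def sum.lessThan_Suc_shift add.commute del: sum.lessThan_Suc)
qed

text \<open>Naturality \<open>d(\<phi>\<^sup>*\<eta>) = \<phi>\<^sup>*(d\<eta>)\<close>. Differentiating \<open>\<eta> (\<phi> y) (map (\<phi>' y) vs)\<close> gives the pulled back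
  derivative of \<open>\<eta>\<close> and terms with the second derivative of \<open>\<phi>\<close>, which disappear in the skew sum.\<close>

lemma local_d_pullback:
  fixes \<phi> :: "'a::euclidean_space \<Rightarrow> 'e::euclidean_space"
  assumes \<eta>: "form_on n S \<eta>" and U: "open U" "x \<in> U" "\<phi> ` U \<subseteq> S" and \<phi>: "smooth_on U \<phi>"
    and \<zeta>: "\<And>y ws. y \<in> U \<Longrightarrow> \<zeta> y ws = \<eta> (\<phi> y) (map (frechet_derivative \<phi> (at y)) ws)"
  shows "local_d \<zeta> x ws = local_d \<eta> (\<phi> x) (map (frechet_derivative \<phi> (at x)) ws)"
proof -
  define L where "L = frechet_derivative \<phi> (at x)"
  define B where "B u v = frechet_derivative (\<lambda>y. frechet_derivative \<phi> (at y) v) (at x) u" for u v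
  have "frechet_derivative (\<lambda>y. \<zeta> y vs) (at x) u =
      frechet_derivative (\<lambda>z. \<eta> z (map L vs)) (at (\<phi> x)) (L u) +
      (\<Sum>j<length vs. \<eta> (\<phi> x) ((map L vs)[j := B u (vs ! j)]))" for u vs
  proof -
    have D: "((\<lambda>y. \<eta> (\<phi> y) ([] @ map (\<lambda>w. frechet_derivative \<phi> (at y) w) vs)) has_derivative
      (\<lambda>h. frechet_derivative (\<lambda>z. \<eta> z ([] @ map (\<lambda>w. frechet_derivative \<phi> (at x) w) vs)) (at (\<phi> x)) (L h) +
        (\<Sum>j<length vs. \<eta> (\<phi> x) ([] @ (map (\<lambda>w. frechet_derivative \<phi> (at x) w) vs)[j := B h (vs ! j)])))) (at x)"
      unfolding L_def B_def
      by (rule has_derivative_form_variable_arguments[OF \<eta> U])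
        (rule smooth_on_has_derivative[OF \<phi> U(2)]
          smooth_on_has_derivative[OF smooth_on_frechet_derivative[OF \<phi>] U(2)])+
    have "frechet_derivative (\<lambda>y. \<zeta> y vs) (at x) =
        frechet_derivative (\<lambda>y. \<eta> (\<phi> y) ([] @ map (\<lambda>w. frechet_derivative \<phi> (at y) w) vs)) (at x)"
      by (rule frechet_derivative_cong[OF U(1,2)]) (simp add: \<zeta>)
    then show ?thesis
      using frechet_derivative_at[OF D, symmetric] by (simp add: L_def)
  qed
  then have "local_d \<zeta> x ws =
      skew_sum (\<lambda>u vs. frechet_derivative (\<lambda>z. \<eta> z (map L vs)) (at (\<phi> x)) (L u)) ws +
      skew_sum (\<lambda>u vs. \<Sum>j<length vs. \<eta> (\<phi> x) ((map L vs)[j := B u (vs ! j)])) ws"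
    by (simp add: local_d_def skew_sum_add)
  also have "skew_sum (\<lambda>u vs. \<Sum>j<length vs. \<eta> (\<phi> x) ((map L vs)[j := B u (vs ! j)])) ws = 0"
  proof (rule skew_sum_symmetric_insertion)
    show "alternating n (\<eta> (\<phi> x))" using \<eta> U unfolding form_on_def by blast
    show "B u v = B v u" for u v
      unfolding B_def by (rule second_derivative_symmetric[OF U(1,2) \<phi>])
  qed
  finally show ?thesis by (simp add: local_d_def skew_sum_map L_def)
qed

section \<open>Charts and tangent vectors\<close>

lemma charts_atD: "c \<in> charts_at M p \<Longrightarrow> c \<in> atlas M" "c \<in> charts_at M p \<Longrightarrow> p \<in> fst c"
  and charts_atI: "c \<in> atlas M \<Longrightarrow> p \<in> fst c \<Longrightarrow> c \<in> charts_at M p"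
  by (simp_all add: charts_at_def)

lemma chart_subset_points: "smooth_manifold M \<Longrightarrow> c \<in> atlas M \<Longrightarrow> fst c \<subseteq> points M"
  unfolding smooth_manifold_def by blast

lemma charts_at_point:
  assumes "smooth_manifold M" "c \<in> charts_at M p"
  shows "p \<in> points M"
  using chart_subset_points[OF assms(1) charts_atD(1)[OF assms(2)]] charts_atD(2)[OF assms(2)] by blast

lemma chart_at_in_charts_at:
  assumes "smooth_manifold M" "p \<in> points M"
  shows "chart_at M p \<in> charts_at M p"
proof -
  have "\<exists>c. c \<in> charts_at M p"
    using assms unfolding smooth_manifold_def charts_at_def by blast
  then show ?thesis unfolding chart_at_def by (rule someI_ex)
qed

lemma chart_homeomorphic_map:
  "smooth_manifold M \<Longrightarrow> c \<in> atlas M \<Longrightarrow>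
    homeomorphic_map (subtopology (mtop M) (fst c)) (top_of_set (snd c ` fst c)) (snd c)"
  unfolding smooth_manifold_def by blast

lemma chart_inj_on:
  assumes "smooth_manifold M" "c \<in> atlas M"
  shows "inj_on (snd c) (fst c)"
proof -
  have "topspace (subtopology (mtop M) (fst c)) = fst c"
    using chart_subset_points[OF assms] by auto
  then show ?thesis
    using homeomorphic_imp_injective_map[OF chart_homeomorphic_map[OF assms]] by simp
qed

lemma chart_inv_chart:
  "smooth_manifold M \<Longrightarrow> c \<in> atlas M \<Longrightarrow> p \<in> fst c \<Longrightarrow> chart_inv c (snd c p) = p"
  unfolding chart_inv_def by (rule inv_into_f_f[OF chart_inj_on])

lemma chart_inv_in: "x \<in> snd c ` fst c \<Longrightarrow> chart_inv c x \<in> fst c"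
  unfolding chart_inv_def by (rule inv_into_into)

lemma chart_chart_inv: "x \<in> snd c ` fst c \<Longrightarrow> snd c (chart_inv c x) = x"
  unfolding chart_inv_def by (rule f_inv_into_f)

lemma open_chart_image:
  "smooth_manifold M \<Longrightarrow> c \<in> atlas M \<Longrightarrow> open (snd c ` fst c)"
  unfolding smooth_manifold_def by blast

lemma open_chart_overlap:
  assumes "smooth_manifold M" "c \<in> atlas M" "c' \<in> atlas M"
  shows "open (snd c ` (fst c \<inter> fst c'))"
proof -
  have "openin (mtop M) (fst c')"
    using assms unfolding smooth_manifold_def by blast
  then have "openin (subtopology (mtop M) (fst c)) (fst c \<inter> fst c')"
    by (metis inf_commute openin_subtopology_Int)
  then have "openin (top_of_set (snd c ` fst c)) (snd c ` (fst c \<inter> fst c'))"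
    using homeomorphic_imp_open_map[OF chart_homeomorphic_map[OF assms(1,2)]]
    unfolding open_map_def by blast
  then show ?thesis
    by (rule openin_open_trans[OF _ open_chart_image[OF assms(1,2)]])
qed

definition overlap :: "('a, 'e) chart \<Rightarrow> ('a, 'f) chart \<Rightarrow> 'e set" where
  "overlap c c' = snd c ` (fst c \<inter> fst c')"

abbreviation coord_change ::
  "('a, 'e::euclidean_space) chart \<Rightarrow> ('a, 'f::euclidean_space) chart \<Rightarrow> 'a \<Rightarrow> 'e \<Rightarrow> 'f" where
  "coord_change c c' p \<equiv> frechet_derivative (transition c c') (at (snd c p))"

lemma transition_smooth:
  "smooth_manifold M \<Longrightarrow> c \<in> atlas M \<Longrightarrow> c' \<in> atlas M \<Longrightarrow> smooth_on (overlap c c') (transition c c')"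
  unfolding smooth_manifold_def overlap_def by blast

lemma transition_chart:
  "smooth_manifold M \<Longrightarrow> c \<in> atlas M \<Longrightarrow> p \<in> fst c \<Longrightarrow> transition c c' (snd c p) = snd c' p"
  by (simp add: transition_def chart_inv_chart)

lemma coord_change_has_derivative:
  assumes "smooth_manifold M" "c \<in> charts_at M p" "c' \<in> charts_at M p"
  shows "(transition c c' has_derivative coord_change c c' p) (at (snd c p))"
  by (rule smooth_on_has_derivative[OF transition_smooth[OF assms(1)]])
    (use assms in \<open>auto simp: charts_at_def overlap_def\<close>)

lemma coord_change_linear:
  "smooth_manifold M \<Longrightarrow> c \<in> charts_at M p \<Longrightarrow> c' \<in> charts_at M p \<Longrightarrow> linear (coord_change c c' p)"
  by (rule has_derivative_linear[OF coord_change_has_derivative])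

lemma coord_change_self:
  assumes "smooth_manifold M" "c \<in> charts_at M p"
  shows "coord_change c c p w = w"
proof -
  have "coord_change c c p = frechet_derivative (\<lambda>x. x) (at (snd c p))"
  proof (rule frechet_derivative_cong)
    show "open (snd c ` fst c)"
      by (rule open_chart_image[OF assms(1) charts_atD(1)[OF assms(2)]])
    show "snd c p \<in> snd c ` fst c"
      using assms(2) by (simp add: charts_at_def)
  qed (simp add: transition_def chart_chart_inv)
  then show ?thesis by simp
qed

text \<open>The chain rule, applied to transition maps; this cocycle identity makes \<open>tvec_of\<close> produce
  tangent vectors.\<close>

lemma coord_change_compose:
  assumes M: "smooth_manifold M"
    and c: "c \<in> charts_at M p" "c' \<in> charts_at M p" "c'' \<in> charts_at M p"
  shows "coord_change c' c'' p (coord_change c c' p w) = coord_change c c'' p w"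
proof -
  note a = charts_atD(1)[OF c(1)] charts_atD(1)[OF c(2)] charts_atD(1)[OF c(3)]
  have inv: "chart_inv c (snd c q) = q" if "q \<in> fst c" for q
    using chart_inv_chart[OF M a(1) that] .
  have inv': "chart_inv c' (snd c' q) = q" if "q \<in> fst c'" for q
    using chart_inv_chart[OF M a(2) that] .
  have p: "snd c p \<in> snd c ` (fst c \<inter> fst c')"
    using c by (auto simp: charts_at_def)
  have D: "((\<lambda>y. transition c' c'' (transition c c' y)) has_derivative
      (\<lambda>w. coord_change c' c'' p (coord_change c c' p w))) (at (snd c p))"
    using has_derivative_compose[OF coord_change_has_derivative[OF M c(1,2)],
        of "transition c' c''" "coord_change c' c'' p"]
      coord_change_has_derivative[OF M c(2,3)]
    by (simp add: transition_chart[OF M a(1) charts_atD(2)[OF c(1)]])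
  have "(transition c c'' has_derivative
      (\<lambda>w. coord_change c' c'' p (coord_change c c' p w))) (at (snd c p))"
    by (rule has_derivative_transform_within_open[OF D open_chart_overlap[OF M a(1,2)] p])
      (auto simp: transition_def inv inv')
  from frechet_derivative_at[OF this] show ?thesis by metis
qed

lemma tvec_of_in_tangent_space:
  assumes "smooth_manifold M" "c \<in> charts_at M p"
  shows "tvec_of M c p w \<in> tangent_space M p"
  by (simp add: tangent_space_def tvec_of_def coord_change_compose[OF assms])

lemma tvec_of_coord_self:
  "smooth_manifold M \<Longrightarrow> c \<in> charts_at M p \<Longrightarrow> tvec_of M c p w c = w"
  by (simp add: tvec_of_def coord_change_self)

lemma tangent_coord_change:
  "v \<in> tangent_space M p \<Longrightarrow> c \<in> charts_at M p \<Longrightarrow> c' \<in> charts_at M p \<Longrightarrow>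
    v c' = coord_change c c' p (v c)"
  unfolding tangent_space_def by blast

lemma tvec_of_coord:
  assumes "v \<in> tangent_space M p" "c \<in> charts_at M p"
  shows "tvec_of M c p (v c) = v"
proof
  fix c'
  show "tvec_of M c p (v c) c' = v c'"
  proof (cases "c' \<in> charts_at M p")
    case True
    then show ?thesis using tangent_coord_change[OF assms True] by (simp add: tvec_of_def)
  next
    case False
    then have "v c' = 0" using assms(1) unfolding tangent_space_def by blast
    then show ?thesis using False by (simp add: tvec_of_def)
  qed
qed

lemma tvec_of_coord_change:
  assumes "smooth_manifold M" "c \<in> charts_at M p" "c' \<in> charts_at M p"
  shows "tvec_of M c' p (coord_change c c' p w) = tvec_of M c p w"
  by (rule ext) (simp add: tvec_of_def coord_change_compose[OF assms])

lemma tvec_of_tcomb: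
  assumes "smooth_manifold M" "c \<in> charts_at M p"
  shows "tvec_of M c p (a *\<^sub>R u + b *\<^sub>R w) = tcomb a (tvec_of M c p u) b (tvec_of M c p w)"
proof
  fix c'
  show "tvec_of M c p (a *\<^sub>R u + b *\<^sub>R w) c' = tcomb a (tvec_of M c p u) b (tvec_of M c p w) c'"
  proof (cases "c' \<in> charts_at M p")
    case True
    note lin = coord_change_linear[OF assms True]
    show ?thesis
      using True by (simp add: tvec_of_def tcomb_def linear_add[OF lin] linear_scale[OF lin])
  qed (simp add: tvec_of_def tcomb_def)
qed

lemma tcomb_in_tangent_space:
  assumes M: "smooth_manifold M" and p: "p \<in> points M"
    and "v \<in> tangent_space M p" "w \<in> tangent_space M p"
  shows "tcomb a v b w \<in> tangent_space M p"
proof -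
  note c = chart_at_in_charts_at[OF M p]
  have "tcomb a v b w = tvec_of M (chart_at M p) p (a *\<^sub>R v (chart_at M p) + b *\<^sub>R w (chart_at M p))"
    by (simp only: tvec_of_tcomb[OF M c] tvec_of_coord[OF assms(3) c] tvec_of_coord[OF assms(4) c])
  then show ?thesis using tvec_of_in_tangent_space[OF M c] by simp
qed

lemma tvec_eq_iff:
  assumes "c \<in> charts_at M p" "v \<in> tangent_space M p" "w \<in> tangent_space M p"
  shows "v = w \<longleftrightarrow> v c = w c"
  using arg_cong[of "v c" "w c" "tvec_of M c p"]
  unfolding tvec_of_coord[OF assms(2,1)] tvec_of_coord[OF assms(3,1)] by blast

lemma tzero_in_tangent_space:
  assumes "smooth_manifold M" "p \<in> points M"
  shows "tzero \<in> tangent_space M p"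
proof -
  note c = chart_at_in_charts_at[OF assms]
  have eq: "tzero = tcomb 0 (tvec_of M (chart_at M p) p 0) 0 (tvec_of M (chart_at M p) p 0)"
    by (simp add: tcomb_def tzero_def)
  show ?thesis
    unfolding eq
    by (intro tcomb_in_tangent_space[OF assms] tvec_of_in_tangent_space[OF assms(1) c])
qed

section \<open>Differential forms and the exterior derivative in charts\<close>

lemma map_tvec_of_coord:
  assumes "set vs \<subseteq> tangent_space M p" "c \<in> charts_at M p"
  shows "map (tvec_of M c p) (map (\<lambda>v. v c) vs) = vs"
  unfolding map_map o_def
  by (rule map_idI, rule tvec_of_coord[OF _ assms(2)]) (use assms(1) in blast)

lemma map_coord_tvec_of:
  assumes "smooth_manifold M" "c \<in> charts_at M p"
  shows "map (\<lambda>v. v c) (map (tvec_of M c p) ws) = ws"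
  by (simp add: o_def tvec_of_coord_self[OF assms])

lemma local_form_chart:
  "smooth_manifold M \<Longrightarrow> c \<in> charts_at M p \<Longrightarrow>
    local_form M \<omega> c (snd c p) ws = \<omega> p (map (tvec_of M c p) ws)"
  by (simp add: local_form_def charts_at_def chart_inv_chart)

lemma form_eq_local_form:
  assumes "smooth_manifold M" "c \<in> charts_at M p" "set vs \<subseteq> tangent_space M p"
  shows "\<omega> p vs = local_form M \<omega> c (snd c p) (map (\<lambda>v. v c) vs)"
  unfolding local_form_chart[OF assms(1,2)] map_tvec_of_coord[OF assms(3,2)] by (rule refl)

lemma diff_form_zero:
  assumes "diff_form n M \<omega>" "\<not> (p \<in> points M \<and> length vs = n \<and> set vs \<subseteq> tangent_space M p)"
  shows "\<omega> p vs = 0"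
  using assms(1)[unfolded diff_form_def, THEN conjunct1] assms(2) by (elim allE impE)

lemma alternating_local_form:
  assumes M: "smooth_manifold M" and \<omega>: "diff_form n M \<omega>" and c: "c \<in> charts_at M p"
  shows "alternating n (local_form M \<omega> c (snd c p))"
proof -
  have p: "p \<in> points M"
    by (rule charts_at_point[OF M c])
  have tangent: "set (map (tvec_of M c p) ws) \<subseteq> tangent_space M p" for ws
    using tvec_of_in_tangent_space[OF M c] by auto
  have multilinear: "\<omega> p (vs[i := tcomb a v b w]) = a * \<omega> p (vs[i := v]) + b * \<omega> p (vs[i := w])"
    if "length vs = n" "set vs \<subseteq> tangent_space M p" "i < n" "v \<in> tangent_space M p"
      "w \<in> tangent_space M p" for vs i v w a b
    using \<omega> that p unfolding diff_form_def by blast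
  have repeat: "\<omega> p vs = 0"
    if "length vs = n" "set vs \<subseteq> tangent_space M p" "i < n" "j < n" "i \<noteq> j" "vs ! i = vs ! j" for vs i j
    using \<omega> that p unfolding diff_form_def by blast
  have comb: "\<omega> p (map (tvec_of M c p) (xs @ (a *\<^sub>R v + b *\<^sub>R w) # ys)) =
      a * \<omega> p (map (tvec_of M c p) (xs @ v # ys)) + b * \<omega> p (map (tvec_of M c p) (xs @ w # ys))"
    for xs ys v w a b
  proof (cases "length (xs @ v # ys) = n")
    case True
    have upd: "(map (tvec_of M c p) (xs @ v # ys))[length xs := t] =
        map (tvec_of M c p) xs @ t # map (tvec_of M c p) ys" for t
      by (simp add: list_update_append)
    show ?thesis
      using multilinear[of "map (tvec_of M c p) (xs @ v # ys)" "length xs" "tvec_of M c p v" "tvec_of M c p w" a b,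
          OF _ tangent] True tvec_of_in_tangent_space[OF M c]
      unfolding upd by (simp add: tvec_of_tcomb[OF M c])
  next
    case False
    then show ?thesis by (simp add: diff_form_zero[OF \<omega>])
  qed
  show ?thesis
    unfolding alternating_def local_form_chart[OF M c]
  proof (intro conjI allI impI)
    show "\<omega> p (map (tvec_of M c p) vs) = 0" if "length vs \<noteq> n" for vs
      using that by (simp add: diff_form_zero[OF \<omega>])
    show "linear (\<lambda>v. \<omega> p (map (tvec_of M c p) (xs @ v # ys)))" for xs ys
      using comb[of xs 1 _ 1] comb[of xs _ _ 0 0] by (intro linearI) simp_all
    show "\<omega> p (map (tvec_of M c p) (xs @ v # ys @ v # zs)) = 0" for xs v ys zs
    proof (cases "length (xs @ v # ys @ v # zs) = n")
      case True
      show ?thesis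
        by (rule repeat[OF _ tangent, of _ "length xs" "Suc (length xs + length ys)"])
          (use True in \<open>simp_all add: nth_append\<close>)
    next
      case False
      then show ?thesis by (simp add: diff_form_zero[OF \<omega>])
    qed
  qed
qed

lemma form_on_local_form:
  assumes M: "smooth_manifold M" and \<omega>: "diff_form n M \<omega>" and c: "c \<in> atlas M"
  shows "form_on n (snd c ` fst c) (local_form M \<omega> c)"
proof -
  have "alternating n (local_form M \<omega> c x)" if x: "x \<in> snd c ` fst c" for x
  proof -
    obtain p where "x = snd c p" "p \<in> fst c" using x by blast
    then show ?thesis using alternating_local_form[OF M \<omega> charts_atI[OF c]] by simp
  qed
  moreover have "smooth_on (snd c ` fst c) (\<lambda>x. local_form M \<omega> c x ws)" for ws
  proof (cases "length ws = n")
    case True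
    then show ?thesis using \<omega> c unfolding diff_form_def by blast
  next
    case False
    then have "local_form M \<omega> c x ws = 0" for x
      by (simp add: local_form_def diff_form_zero[OF \<omega>])
    then show ?thesis by simp
  qed
  ultimately show ?thesis
    using open_chart_image[OF M c] unfolding form_on_def by blast
qed

text \<open>The converse of \<open>form_on_local_form\<close>: tangent vectors correspond to their coordinate
  vectors in any one chart around the point, so fibrewise conditions can be checked there.\<close>

lemma diff_formI:
  assumes M: "smooth_manifold M"
    and zero: "\<And>p vs. \<not> (p \<in> points M \<and> length vs = n \<and> set vs \<subseteq> tangent_space M p) \<Longrightarrow> \<omega> p vs = 0"
    and local: "\<And>c. c \<in> atlas M \<Longrightarrow> form_on n (snd c ` fst c) (local_form M \<omega> c)"
  shows "diff_form n M \<omega>"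
  unfolding diff_form_def
proof (intro conjI ballI allI impI)
  show "\<omega> p vs = 0" if "\<not> (p \<in> points M \<and> length vs = n \<and> set vs \<subseteq> tangent_space M p)" for p vs
    using that by (rule zero)
  show "smooth_on (snd c ` fst c) (\<lambda>x. local_form M \<omega> c x ws)" if "c \<in> atlas M" for c ws
    using local[OF that] unfolding form_on_def by blast
next
  fix p vs i v w and a b :: real
  assume p: "p \<in> points M" and vs: "length vs = n \<and> set vs \<subseteq> tangent_space M p" and i: "i < n"
    and v: "v \<in> tangent_space M p" and w: "w \<in> tangent_space M p"
  define c where "c = chart_at M p"
  have c: "c \<in> charts_at M p" unfolding c_def by (rule chart_at_in_charts_at[OF M p])
  have alt: "alternating n (local_form M \<omega> c (snd c p))"
    using local[of c] c unfolding form_on_def charts_at_def by blast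
  define f where "f u = local_form M \<omega> c (snd c p)
      (map (\<lambda>v. v c) (take i vs) @ u # map (\<lambda>v. v c) (drop (Suc i) vs))" for u
  have f: "\<omega> p (vs[i := t]) = f (t c)" if "t \<in> tangent_space M p" for t
  proof -
    have "set (vs[i := t]) \<subseteq> tangent_space M p"
      using vs that set_update_subset_insert[of vs i t] by blast
    then show ?thesis
      using vs i form_eq_local_form[OF M c, of "vs[i := t]" \<omega>]
      by (simp add: f_def upd_conv_take_nth_drop)
  qed
  have lin: "linear f"
    unfolding f_def by (rule alternating_linear[OF alt])
  show "\<omega> p (vs[i := tcomb a v b w]) = a * \<omega> p (vs[i := v]) + b * \<omega> p (vs[i := w])"
    using tcomb_in_tangent_space[OF M p v w] v w
    by (simp add: f tcomb_def linear_add[OF lin] linear_scale[OF lin])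
next
  fix p vs i j
  assume p: "p \<in> points M" and vs: "length vs = n \<and> set vs \<subseteq> tangent_space M p"
    and ij: "i < n" "j < n" "i \<noteq> j \<and> vs ! i = vs ! j"
  define c where "c = chart_at M p"
  have c: "c \<in> charts_at M p" unfolding c_def by (rule chart_at_in_charts_at[OF M p])
  have alt: "alternating n (local_form M \<omega> c (snd c p))"
    using local[of c] c unfolding form_on_def charts_at_def by blast
  \<comment> \<open>\<open>l\<close> is one less than the larger position, as \<open>list_split_at_two\<close> splits at \<open>k\<close> and \<open>Suc l\<close>.\<close>
  define k l where "k = min i j" and "l = max i j - 1"
  have kl: "k \<le> l" "Suc l < length vs" "vs ! k = vs ! Suc l"
    using ij vs by (auto simp: k_def l_def min_def max_def)
  obtain P Q R a where split: "vs = P @ a # Q @ a # R"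
    by (rule list_split_at_two[OF kl(1,2)]) (use kl(3) that in simp)
  have "\<omega> p vs = local_form M \<omega> c (snd c p) (map (\<lambda>v. v c) vs)"
    by (rule form_eq_local_form[OF M c]) (use vs in blast)
  also have "map (\<lambda>v. v c) vs = map (\<lambda>v. v c) P @ a c # map (\<lambda>v. v c) Q @ a c # map (\<lambda>v. v c) R"
    by (simp add: split)
  finally show "\<omega> p vs = 0" by (simp add: alternating_repeat[OF alt])
qed

lemma local_form_change:
  assumes M: "smooth_manifold M" and c: "c \<in> atlas M" "c' \<in> atlas M" and x: "x \<in> overlap c c'"
  shows "local_form M \<omega> c x ws = local_form M \<omega> c' (transition c c' x)
    (map (frechet_derivative (transition c c') (at x)) ws)"
proof -
  obtain p where p: "x = snd c p" "p \<in> fst c" "p \<in> fst c'" using x by (auto simp: overlap_def)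
  then have cp: "c \<in> charts_at M p" "c' \<in> charts_at M p" using c by (auto simp: charts_at_def)
  show ?thesis
    unfolding p(1) transition_chart[OF M c(1) p(2)] local_form_chart[OF M cp(1)]
      local_form_chart[OF M cp(2)]
    by (simp add: o_def tvec_of_coord_change[OF M cp])
qed

text \<open>The definition uses one chosen chart around each point. Naturality of the local exterior
  derivative under transition maps makes every chart around \<open>p\<close> admissible.\<close>

lemma ext_deriv_local:
  assumes M: "smooth_manifold M" and \<omega>: "diff_form n M \<omega>" and c: "c \<in> charts_at M p"
    and vs: "set vs \<subseteq> tangent_space M p"
  shows "ext_deriv M \<omega> p vs = local_d (local_form M \<omega> c) (snd c p) (map (\<lambda>v. v c) vs)"
proof -
  have p: "p \<in> points M"
    by (rule charts_at_point[OF M c])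
  define c0 where "c0 = chart_at M p"
  have c0: "c0 \<in> charts_at M p" unfolding c0_def by (rule chart_at_in_charts_at[OF M p])
  note a = charts_atD(1)[OF c0] charts_atD(1)[OF c]
  have "ext_deriv M \<omega> p vs = local_d (local_form M \<omega> c0) (snd c0 p) (map (\<lambda>v. v c0) vs)"
    using p vs
    by (simp add: ext_deriv_def local_d_def skew_sum_def omit_map Let_def c0_def)
  also have "\<dots> = local_d (local_form M \<omega> c) (transition c0 c (snd c0 p))
      (map (coord_change c0 c p) (map (\<lambda>v. v c0) vs))"
  proof (rule local_d_pullback[OF form_on_local_form[OF M \<omega> a(2)]])
    show "open (overlap c0 c)"
      unfolding overlap_def by (rule open_chart_overlap[OF M a])
    show "snd c0 p \<in> overlap c0 c"
      using c c0 by (auto simp: overlap_def charts_at_def)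
    show "transition c0 c ` overlap c0 c \<subseteq> snd c ` fst c"
    proof
      fix y assume "y \<in> transition c0 c ` overlap c0 c"
      then obtain q where "q \<in> fst c0" "q \<in> fst c" "y = transition c0 c (snd c0 q)"
        by (auto simp: overlap_def)
      then show "y \<in> snd c ` fst c" using transition_chart[OF M a(1), of q c] by simp
    qed
    show "smooth_on (overlap c0 c) (transition c0 c)"
      by (rule transition_smooth[OF M a])
  qed (rule local_form_change[OF M a])
  also have "transition c0 c (snd c0 p) = snd c p"
    using transition_chart[OF M a(1) charts_atD(2)[OF c0]] .
  also have "map (coord_change c0 c p) (map (\<lambda>v. v c0) vs) = map (\<lambda>v. v c) vs"
  proof -
    have "coord_change c0 c p (v c0) = v c" if "v \<in> set vs" for v
      by (rule tangent_coord_change[OF _ c0 c, symmetric]) (use that vs in blast)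
    then show ?thesis by simp
  qed
  finally show ?thesis .
qed

lemma local_form_ext_deriv:
  assumes M: "smooth_manifold M" and \<omega>: "diff_form n M \<omega>" and c: "c \<in> atlas M"
    and x: "x \<in> snd c ` fst c"
  shows "local_form M (ext_deriv M \<omega>) c x ws = local_d (local_form M \<omega> c) x ws"
proof -
  obtain p where p: "x = snd c p" "p \<in> fst c" using x by blast
  then have cp: "c \<in> charts_at M p" using c by (simp add: charts_at_def)
  have "set (map (tvec_of M c p) ws) \<subseteq> tangent_space M p"
    using tvec_of_in_tangent_space[OF M cp] by auto
  then show ?thesis
    unfolding p(1) local_form_chart[OF M cp]
    by (simp only: ext_deriv_local[OF M \<omega> cp] map_coord_tvec_of[OF M cp])
qed

lemma local_d_cong:
  assumes "open S" "x \<in> S" "\<And>y ws. y \<in> S \<Longrightarrow> \<eta> y ws = \<zeta> y ws"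
  shows "local_d \<eta> x = local_d \<zeta> x"
proof -
  have "frechet_derivative (\<lambda>y. \<eta> y vs) (at x) = frechet_derivative (\<lambda>y. \<zeta> y vs) (at x)" for vs
    by (rule frechet_derivative_cong[OF assms(1,2)]) (rule assms(3))
  then show ?thesis by (simp add: local_d_def)
qed

lemma form_on_cong:
  assumes "form_on n S \<eta>" "\<And>x ws. x \<in> S \<Longrightarrow> \<eta> x ws = \<zeta> x ws"
  shows "form_on n S \<zeta>"
proof -
  have S: "open S" using assms(1) unfolding form_on_def by blast
  have eq: "\<eta> x = \<zeta> x" if "x \<in> S" for x
    using assms(2)[OF that] by blast
  have "smooth_on S (\<lambda>x. \<zeta> x ws)" if "smooth_on S (\<lambda>x. \<eta> x ws)" for ws
    using that smooth_on_cong[OF S, of "\<lambda>x. \<eta> x ws" "\<lambda>x. \<zeta> x ws"] assms(2) by blast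
  then show ?thesis using assms(1) eq unfolding form_on_def by auto
qed

text \<open>The definition of \<open>ext_deriv\<close> does not mention the degree; on lists of a wrong length all its
  terms are derivatives of functions that vanish on the chart.\<close>

lemma ext_deriv_zero:
  assumes M: "smooth_manifold M" and \<omega>: "diff_form n M \<omega>"
    and "\<not> (p \<in> points M \<and> length vs = Suc n \<and> set vs \<subseteq> tangent_space M p)"
  shows "ext_deriv M \<omega> p vs = 0"
proof (cases "p \<in> points M \<and> set vs \<subseteq> tangent_space M p")
  case True
  define c where "c = chart_at M p"
  have c: "c \<in> charts_at M p" unfolding c_def using True chart_at_in_charts_at[OF M] by blast
  have "alternating (Suc n) (local_d (local_form M \<omega> c) (snd c p))"
    using form_on_local_d[OF form_on_local_form[OF M \<omega>]] c unfolding form_on_def charts_at_def by blast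
  then show ?thesis
    using alternating_length[of "Suc n" _ "map (\<lambda>v. v c) vs"] assms(3) True
    by (simp add: ext_deriv_local[OF M \<omega> c])
qed (auto simp: ext_deriv_def)

lemma diff_form_ext_deriv:
  assumes M: "smooth_manifold M" and \<omega>: "diff_form n M \<omega>"
  shows "diff_form (Suc n) M (ext_deriv M \<omega>)"
proof (rule diff_formI[OF M ext_deriv_zero[OF M \<omega>]])
  show "form_on (Suc n) (snd c ` fst c) (local_form M (ext_deriv M \<omega>) c)" if c: "c \<in> atlas M" for c
    by (rule form_on_cong[OF form_on_local_d[OF form_on_local_form[OF M \<omega> c]]])
      (rule local_form_ext_deriv[OF M \<omega> c, symmetric])
qed

lemma ext_deriv_ext_deriv:
  assumes M: "smooth_manifold M" and \<omega>: "diff_form n M \<omega>"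
  shows "ext_deriv M (ext_deriv M \<omega>) = form_zero"
proof (intro ext)
  fix p vs
  show "ext_deriv M (ext_deriv M \<omega>) p vs = form_zero p vs"
  proof (cases "p \<in> points M \<and> set vs \<subseteq> tangent_space M p")
    case True
    define c where "c = chart_at M p"
    have c: "c \<in> charts_at M p" unfolding c_def using True chart_at_in_charts_at[OF M] by blast
    note a = charts_atD(1)[OF c]
    have p: "snd c p \<in> snd c ` fst c" using c by (simp add: charts_at_def)
    have "ext_deriv M (ext_deriv M \<omega>) p vs =
        local_d (local_form M (ext_deriv M \<omega>) c) (snd c p) (map (\<lambda>v. v c) vs)"
      using ext_deriv_local[OF M diff_form_ext_deriv[OF M \<omega>] c] True by blast
    also have "\<dots> = local_d (local_d (local_form M \<omega> c)) (snd c p) (map (\<lambda>v. v c) vs)"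
      using local_d_cong[OF open_chart_image[OF M a] p, of "local_form M (ext_deriv M \<omega>) c"
          "local_d (local_form M \<omega> c)"] local_form_ext_deriv[OF M \<omega> a] by simp
    also have "\<dots> = 0"
      by (rule local_d_local_d[OF form_on_local_form[OF M \<omega> a] p])
    finally show ?thesis by (simp add: form_zero_def)
  qed (auto simp: ext_deriv_def form_zero_def)
qed

lemma diff_form_uminus:
  assumes "smooth_manifold M" "diff_form n M \<omega>"
  shows "diff_form n M (form_uminus \<omega>)"
proof (rule diff_formI[OF assms(1)])
  show "form_on n (snd c ` fst c) (local_form M (form_uminus \<omega>) c)" if c: "c \<in> atlas M" for c
  proof -
    have \<eta>: "form_on n (snd c ` fst c) (local_form M \<omega> c)"
      by (rule form_on_local_form[OF assms c])
    have eq: "local_form M (form_uminus \<omega>) c x ws = - local_form M \<omega> c x ws" for x ws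
      by (simp add: local_form_def form_uminus_def)
    have "alternating n (\<lambda>ws. - \<alpha> ws)" if "alternating n \<alpha>" for \<alpha> :: "'b list \<Rightarrow> real"
      using that unfolding alternating_def by (auto intro: linear_compose_neg)
    moreover have "smooth_on (snd c ` fst c) (\<lambda>x. - local_form M \<omega> c x ws)" for ws
      using \<eta> smooth_on_compose_linear_left[OF bounded_linear_minus[OF bounded_linear_ident]]
      unfolding form_on_def by blast
    ultimately show ?thesis using \<eta> unfolding form_on_def eq by blast
  qed
qed (use diff_form_zero[OF assms(2)] in \<open>auto simp: form_uminus_def\<close>)

lemma ext_deriv_uminus:
  assumes M: "smooth_manifold M" and \<omega>: "diff_form n M \<omega>"
  shows "ext_deriv M (form_uminus \<omega>) = form_uminus (ext_deriv M \<omega>)"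
proof (intro ext)
  fix p vs
  show "ext_deriv M (form_uminus \<omega>) p vs = form_uminus (ext_deriv M \<omega>) p vs"
  proof (cases "p \<in> points M \<and> set vs \<subseteq> tangent_space M p")
    case True
    define c where "c = chart_at M p"
    have c: "c \<in> charts_at M p" unfolding c_def using True chart_at_in_charts_at[OF M] by blast
    have eq: "local_form M (form_uminus \<omega>) c x ws = - local_form M \<omega> c x ws" for x ws
      by (simp add: local_form_def form_uminus_def)
    have "((\<lambda>y. local_form M \<omega> c y ws) has_derivative
        frechet_derivative (\<lambda>y. local_form M \<omega> c y ws) (at (snd c p))) (at (snd c p))" for ws
      using c by (intro form_on_has_derivative[OF form_on_local_form[OF M \<omega>]]) (auto simp: charts_at_def)
    from frechet_derivative_at[OF has_derivative_minus[OF this]]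
    have "frechet_derivative (\<lambda>y. - local_form M \<omega> c y ws) (at (snd c p)) =
        (\<lambda>u. - frechet_derivative (\<lambda>y. local_form M \<omega> c y ws) (at (snd c p)) u)" for ws
      by metis
    then have "local_d (local_form M (form_uminus \<omega>) c) (snd c p) ws =
        - local_d (local_form M \<omega> c) (snd c p) ws" for ws
      by (simp add: local_d_def eq skew_sum_def sum_negf)
    then show ?thesis
      using True ext_deriv_local[OF M \<omega> c] ext_deriv_local[OF M diff_form_uminus[OF M \<omega>] c]
      by (simp add: form_uminus_def)
  qed (auto simp: ext_deriv_def form_uminus_def)
qed

definition first_kernel :: "('v list \<Rightarrow> real) \<Rightarrow> 'v set" where
  "first_kernel \<alpha> = {v. \<forall>ws. \<alpha> (v # ws) = 0}"

lemma ker1_local: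
  assumes M: "smooth_manifold M" and \<omega>: "diff_form n M \<omega>" and c: "c \<in> charts_at M p"
  shows "ker1 M \<omega> p = {v \<in> tangent_space M p. v c \<in> first_kernel (local_form M \<omega> c (snd c p))}"
proof -
  have "int_prod v (\<omega> p) = (\<lambda>vs. 0) \<longleftrightarrow> (\<forall>ws. local_form M \<omega> c (snd c p) (v c # ws) = 0)"
    if v: "v \<in> tangent_space M p" for v
  proof
    assume "int_prod v (\<omega> p) = (\<lambda>vs. 0)"
    then have "\<omega> p (v # map (tvec_of M c p) ws) = 0" for ws
      unfolding int_prod_def by metis
    then show "\<forall>ws. local_form M \<omega> c (snd c p) (v c # ws) = 0"
      by (simp add: local_form_chart[OF M c] tvec_of_coord[OF v c])
  next
    assume *: "\<forall>ws. local_form M \<omega> c (snd c p) (v c # ws) = 0"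
    have "\<omega> p (v # vs) = 0" for vs
    proof (cases "set vs \<subseteq> tangent_space M p")
      case True
      then show ?thesis using * v form_eq_local_form[OF M c, of "v # vs" \<omega>] by simp
    qed (use diff_form_zero[OF \<omega>] in auto)
    then show "int_prod v (\<omega> p) = (\<lambda>vs. 0)" by (simp add: int_prod_def)
  qed
  then show ?thesis unfolding ker1_def first_kernel_def by blast
qed

text \<open>This moves triviality of kernels between \<open>T\<^sub>pM\<close> and the coordinate space.\<close>

lemma tangent_subspace_trivial_iff:
  assumes M: "smooth_manifold M" and c: "c \<in> charts_at M p"
  shows "{v \<in> tangent_space M p. v c \<in> K} = {tzero} \<longleftrightarrow> K = {0}"
proof
  assume K: "K = {0}"
  have zero: "tzero \<in> tangent_space M p"
    by (rule tzero_in_tangent_space[OF M charts_at_point[OF M c]])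
  have zero_c: "tzero c = 0" by (simp add: tzero_def)
  have "v c \<in> K \<longleftrightarrow> v = tzero" if "v \<in> tangent_space M p" for v
    using tvec_eq_iff[OF c that zero] by (simp add: K zero_c)
  then show "{v \<in> tangent_space M p. v c \<in> K} = {tzero}"
    using zero by blast
next
  assume eq: "{v \<in> tangent_space M p. v c \<in> K} = {tzero}"
  have "u = 0" if "u \<in> K" for u
  proof -
    have "tvec_of M c p u \<in> {v \<in> tangent_space M p. v c \<in> K}"
      using that by (simp add: tvec_of_in_tangent_space[OF M c] tvec_of_coord_self[OF M c])
    then have "tvec_of M c p u = tzero" unfolding eq by simp
    then show "u = 0" using tvec_of_coord_self[OF M c, of u] by (simp add: tzero_def)
  qed
  moreover have "0 \<in> K"
  proof -
    have "tzero \<in> {v \<in> tangent_space M p. v c \<in> K}" unfolding eq by simp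
    then show ?thesis by (simp add: tzero_def)
  qed
  ultimately show "K = {0}" by blast
qed

lemma inj_on_int_prod_iff:
  assumes M: "smooth_manifold M" and \<omega>: "diff_form n M \<omega>" and p: "p \<in> points M"
  shows "inj_on (\<lambda>v. int_prod v (\<omega> p)) (tangent_space M p) \<longleftrightarrow> ker1 M \<omega> p = {tzero}"
proof -
  define c where "c = chart_at M p"
  have c: "c \<in> charts_at M p" unfolding c_def by (rule chart_at_in_charts_at[OF M p])
  define \<alpha> where "\<alpha> = local_form M \<omega> c (snd c p)"
  have alt: "alternating n \<alpha>" unfolding \<alpha>_def by (rule alternating_local_form[OF M \<omega> c])
  have lin: "linear (\<lambda>v. \<alpha> (v # ws))" for ws
    using alternating_linear[OF alt, of "[]" ws] by simp
  have ker: "v \<in> ker1 M \<omega> p \<longleftrightarrow> v \<in> tangent_space M p \<and> (\<forall>ws. \<alpha> (v c # ws) = 0)" for v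
    unfolding \<alpha>_def ker1_local[OF M \<omega> c] first_kernel_def by simp
  have zero: "tzero \<in> ker1 M \<omega> p"
    unfolding ker using tzero_in_tangent_space[OF M p] linear_0[OF lin] by (simp add: tzero_def)
  show ?thesis
  proof
    assume inj: "inj_on (\<lambda>v. int_prod v (\<omega> p)) (tangent_space M p)"
    have "v = tzero" if "v \<in> ker1 M \<omega> p" for v
      by (rule inj_onD[OF inj]) (use that zero in \<open>simp_all add: ker1_def\<close>)
    then show "ker1 M \<omega> p = {tzero}" using zero by blast
  next
    assume trivial: "ker1 M \<omega> p = {tzero}"
    show "inj_on (\<lambda>v. int_prod v (\<omega> p)) (tangent_space M p)"
    proof (rule inj_onI)
      fix v w
      assume v: "v \<in> tangent_space M p" and w: "w \<in> tangent_space M p"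
        and eq: "int_prod v (\<omega> p) = int_prod w (\<omega> p)"
      have "\<alpha> (v c # ws) = \<alpha> (w c # ws)" for ws
        using fun_cong[OF eq, of "map (tvec_of M c p) ws"]
        by (simp add: \<alpha>_def int_prod_def local_form_chart[OF M c] tvec_of_coord[OF v c] tvec_of_coord[OF w c])
      then have "\<alpha> (tcomb 1 v (-1) w c # ws) = 0" for ws
        using linear_diff[OF lin, of "v c" "w c" ws] by (simp add: tcomb_def)
      then have "tcomb 1 v (-1) w \<in> ker1 M \<omega> p"
        unfolding ker using tcomb_in_tangent_space[OF M p v w] by blast
      then have "tcomb 1 v (-1) w c = tzero c" using trivial by simp
      then have "v c = w c" by (simp add: tcomb_def tzero_def)
      then show "v = w" using tvec_eq_iff[OF c v w] by blast
    qed
  qed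
qed

section \<open>Products of manifolds\<close>

abbreviation prod_chart :: "('a, 'e) chart \<Rightarrow> ('b, 'f) chart \<Rightarrow> ('a \<times> 'b, 'e \<times> 'f) chart" where
  "prod_chart c d \<equiv> (fst c \<times> fst d, map_prod (snd c) (snd d))"

lemma chart_inv_prod_chart:
  assumes "inj_on (snd c) (fst c)" "inj_on (snd d) (fst d)" "x \<in> snd c ` fst c" "y \<in> snd d ` fst d"
  shows "chart_inv (prod_chart c d) (x, y) = (chart_inv c x, chart_inv d y)"
  unfolding chart_inv_def[of "prod_chart c d"] fst_conv snd_conv
proof (rule inv_into_f_eq)
  show "inj_on (map_prod (snd c) (snd d)) (fst c \<times> fst d)"
    using assms(1,2) by (rule map_prod_inj_on)
  show "(chart_inv c x, chart_inv d y) \<in> fst c \<times> fst d"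
    using assms(3,4) by (simp add: chart_inv_in)
  show "map_prod (snd c) (snd d) (chart_inv c x, chart_inv d y) = (x, y)"
    using assms(3,4) by (simp add: chart_chart_inv)
qed

lemma second_countable_prod_topology:
  assumes "second_countable X" "second_countable Y"
  shows "second_countable (prod_topology X Y)"
proof -
  obtain A where A: "countable A" "\<And>V. V \<in> A \<Longrightarrow> openin X V"
    "\<And>U x. openin X U \<Longrightarrow> x \<in> U \<Longrightarrow> \<exists>V\<in>A. x \<in> V \<and> V \<subseteq> U"
    using assms(1) unfolding second_countable_def by metis
  obtain B where B: "countable B" "\<And>V. V \<in> B \<Longrightarrow> openin Y V"
    "\<And>U x. openin Y U \<Longrightarrow> x \<in> U \<Longrightarrow> \<exists>V\<in>B. x \<in> V \<and> V \<subseteq> U"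
    using assms(2) unfolding second_countable_def by metis
  let ?C = "(\<lambda>(U, V). U \<times> V) ` (A \<times> B)"
  show ?thesis
    unfolding second_countable_def
  proof (intro exI[of _ ?C] conjI allI impI ballI)
    show "countable ?C" using A(1) B(1) by simp
    show "openin (prod_topology X Y) W" if "W \<in> ?C" for W
      using that A(2) B(2) by (auto simp: openin_prod_Times_iff)
    show "\<exists>V\<in>?C. z \<in> V \<and> V \<subseteq> W" if W: "openin (prod_topology X Y) W \<and> z \<in> W" for W z
    proof -
      obtain x y where z: "z = (x, y)" by (cases z)
      obtain U V where UV: "openin X U" "openin Y V" "x \<in> U" "y \<in> V" "U \<times> V \<subseteq> W"
        using W unfolding z openin_prod_topology_alt by metis
      obtain U' V' where UV': "U' \<in> A" "x \<in> U'" "U' \<subseteq> U" "V' \<in> B" "y \<in> V'" "V' \<subseteq> V"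
        using A(3)[OF UV(1,3)] B(3)[OF UV(2,4)] by blast
      have "U' \<times> V' \<in> ?C" using UV'(1,4) by (intro image_eqI[of _ _ "(U', V')"]) simp_all
      moreover have "z \<in> U' \<times> V'" using UV'(2,5) by (simp add: z)
      moreover have "U' \<times> V' \<subseteq> W" using UV'(3,6) UV(5) by blast
      ultimately show ?thesis by blast
    qed
  qed
qed

text \<open>The restriction on \<open>(x, y)\<close> is needed because \<open>inv_into\<close> takes arbitrary values elsewhere;
  all derivatives below are therefore computed on the open chart images only.\<close>

lemma transition_prod_chart:
  assumes M: "smooth_manifold M" and N: "smooth_manifold N"
    and "c \<in> atlas M" "d \<in> atlas N" "x \<in> snd c ` fst c" "y \<in> snd d ` fst d"
  shows "transition (prod_chart c d) (prod_chart c' d') (x, y) = (transition c c' x, transition d d' y)"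
  using chart_inv_prod_chart[OF chart_inj_on[OF M assms(3)] chart_inj_on[OF N assms(4)] assms(5,6)]
  by (simp add: transition_def)

lemma points_prod_mfd: "points (prod_mfd M N) = points M \<times> points N"
  by (simp add: prod_mfd_def)

lemma atlas_prod_mfd:
  "atlas (prod_mfd M N) = {prod_chart c d |c d. c \<in> atlas M \<and> d \<in> atlas N}"
  by (simp add: prod_mfd_def)

lemma homeomorphic_map_prod_chart:
  assumes "homeomorphic_map (subtopology X A) (top_of_set S) f"
    and "homeomorphic_map (subtopology Y B) (top_of_set T) g"
  shows "homeomorphic_map (subtopology (prod_topology X Y) (A \<times> B)) (top_of_set (S \<times> T)) (map_prod f g)"
proof -
  obtain f' g' where f': "homeomorphic_maps (subtopology X A) (top_of_set S) f f'"
    and g': "homeomorphic_maps (subtopology Y B) (top_of_set T) g g'"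
    using assms unfolding homeomorphic_map_maps by blast
  have "homeomorphic_maps (prod_topology (subtopology X A) (subtopology Y B))
      (prod_topology (top_of_set S) (top_of_set T)) (\<lambda>(x, y). (f x, g y)) (\<lambda>(x, y). (f' x, g' y))"
    unfolding homeomorphic_maps_prod using f' g' by blast
  moreover have "(\<lambda>(x, y). (f x, g y)) = map_prod f g"
    by (simp add: map_prod_def)
  ultimately show ?thesis
    unfolding homeomorphic_map_maps by (auto simp: subtopology_Times)
qed

lemma smooth_manifold_prod_mfd:
  assumes M: "smooth_manifold M" and N: "smooth_manifold N"
  shows "smooth_manifold (prod_mfd M N)"
  unfolding smooth_manifold_def
proof (intro conjI ballI)
  have top: "mtop (prod_mfd M N) = prod_topology (mtop M) (mtop N)" by (simp add: prod_mfd_def)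
  show "Hausdorff_space (mtop (prod_mfd M N))"
    using M N unfolding top smooth_manifold_def Hausdorff_space_prod_topology by blast
  show "second_countable (mtop (prod_mfd M N))"
    unfolding top by (rule second_countable_prod_topology) (use M N in \<open>simp_all add: smooth_manifold_def\<close>)
  have union: "(\<Union>C\<in>{f c d |c d. c \<in> A \<and> d \<in> B}. g C) = (\<Union>c\<in>A. \<Union>d\<in>B. g (f c d))"
    for f :: "'x \<Rightarrow> 'y \<Rightarrow> 'z" and g :: "'z \<Rightarrow> 'w set" and A B
    by blast
  have "(\<Union>C\<in>atlas (prod_mfd M N). fst C) = (\<Union>c\<in>atlas M. fst c) \<times> (\<Union>d\<in>atlas N. fst d)"
    unfolding atlas_prod_mfd union fst_conv by blast
  then show "(\<Union>C\<in>atlas (prod_mfd M N). fst C) = points (prod_mfd M N)"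
    using M N unfolding points_prod_mfd smooth_manifold_def by simp
next
  fix C assume "C \<in> atlas (prod_mfd M N)"
  then obtain c d where C: "C = prod_chart c d" and c: "c \<in> atlas M" and d: "d \<in> atlas N"
    unfolding atlas_prod_mfd by blast
  have image: "snd C ` fst C = (snd c ` fst c) \<times> (snd d ` fst d)"
    unfolding C by (simp add: map_prod_image)
  show "openin (mtop (prod_mfd M N)) (fst C)"
    using M N c d unfolding C smooth_manifold_def by (simp add: prod_mfd_def openin_prod_Times_iff)
  show "open (snd C ` fst C)"
    unfolding image by (intro open_Times open_chart_image[OF M c] open_chart_image[OF N d])
  show "homeomorphic_map (subtopology (mtop (prod_mfd M N)) (fst C)) (top_of_set (snd C ` fst C)) (snd C)"
    using homeomorphic_map_prod_chart[OF chart_homeomorphic_map[OF M c] chart_homeomorphic_map[OF N d]]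
    unfolding image by (simp add: prod_mfd_def C)
next
  fix C C' assume "C \<in> atlas (prod_mfd M N)" "C' \<in> atlas (prod_mfd M N)"
  then obtain c d c' d' where C: "C = prod_chart c d" "C' = prod_chart c' d'"
    and c: "c \<in> atlas M" "c' \<in> atlas M" and d: "d \<in> atlas N" "d' \<in> atlas N"
    unfolding atlas_prod_mfd by blast
  have image: "snd C ` (fst C \<inter> fst C') = overlap c c' \<times> overlap d d'"
    unfolding C overlap_def by (simp add: Times_Int_Times map_prod_image)
  have op: "open (overlap c c')" "open (overlap d d')"
    unfolding overlap_def by (rule open_chart_overlap[OF M c] open_chart_overlap[OF N d])+
  have "smooth_on (overlap c c' \<times> overlap d d') (\<lambda>w. (transition c c' (fst w), transition d d' (snd w)))"
    by (intro smooth_on_Pair open_Times op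
        smooth_on_compose_linear_right[OF bounded_linear_fst _ _ transition_smooth[OF M c]]
        smooth_on_compose_linear_right[OF bounded_linear_snd _ _ transition_smooth[OF N d]]) auto
  then have "smooth_on (overlap c c' \<times> overlap d d') (transition C C')"
  proof (rule iffD1[OF smooth_on_cong[OF open_Times[OF op]], rotated])
    fix w assume "w \<in> overlap c c' \<times> overlap d d'"
    then have "fst w \<in> snd c ` fst c" "snd w \<in> snd d ` fst d"
      by (auto simp: overlap_def)
    then show "(transition c c' (fst w), transition d d' (snd w)) = transition C C' w"
      unfolding C using transition_prod_chart[OF M N c(1) d(1), of "fst w" "snd w" c' d'] by simp
  qed
  then show "smooth_on (snd C ` (fst C \<inter> fst C')) (transition C C')"
    unfolding image .
qed

lemma second_countable_euclidean: "second_countable (euclidean :: 'a::second_countable_topology topology)"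
proof -
  obtain \<B> :: "'a set set" where B: "countable \<B>" "topological_basis \<B>"
    using ex_countable_basis by blast
  have base: "\<exists>V\<in>\<B>. x \<in> V \<and> V \<subseteq> U" if "open U" "x \<in> U" for U x
    using topological_basisE[OF B(2) that] by metis
  show ?thesis
    unfolding second_countable_def
    by (rule exI[of _ \<B>]) (use B(1) base topological_basis_open[OF B(2)] in simp)
qed

abbreviation R_chart :: "(real, real) chart" where
  "R_chart \<equiv> (UNIV - {0}, \<lambda>z. z)"

lemma chart_inv_R_chart: "z \<noteq> 0 \<Longrightarrow> chart_inv R_chart z = z"
  unfolding chart_inv_def by (rule inv_into_f_eq) auto

lemma smooth_manifold_R_times: "smooth_manifold R_times"
proof -
  have op: "open (UNIV - {0::real})" by (simp add: open_delete)
  have "smooth_on (UNIV - {0}) (\<lambda>z::real. z)"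
    by (rule smooth_on_bounded_linear[OF bounded_linear_ident])
  then have "smooth_on (UNIV - {0}) (transition R_chart R_chart)"
    by (rule iffD1[OF smooth_on_cong[OF op], rotated]) (simp add: transition_def chart_inv_R_chart)
  moreover have "homeomorphic_map (top_of_set (UNIV - {0})) (top_of_set (UNIV - {0::real})) (\<lambda>z. z)"
    using homeomorphic_map_id[of "top_of_set (UNIV - {0::real})"] by (simp add: id_def)
  ultimately show ?thesis
    using op unfolding smooth_manifold_def R_times_def
    by (simp add: Hausdorff_space_subtopology Hausdorff_space_euclidean second_countable_subtopology
        second_countable_euclidean openin_subtopology_self subtopology_subtopology)
qed

section \<open>The canonical potential in charts\<close>

abbreviation lift_chart :: "('a, 'e) chart \<Rightarrow> ('a \<times> real, 'e \<times> real) chart" where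
  "lift_chart c \<equiv> (fst c \<times> (UNIV - {0}), map_prod (snd c) (\<lambda>z. z))"

lemma smooth_manifold_multisymplectization:
  "smooth_manifold M \<Longrightarrow> smooth_manifold (multisymplectization M)"
  unfolding multisymplectization_def by (rule smooth_manifold_prod_mfd[OF _ smooth_manifold_R_times])

lemma points_multisymplectization: "points (multisymplectization M) = points M \<times> (UNIV - {0})"
  unfolding multisymplectization_def points_prod_mfd by (simp add: R_times_def)

lemma atlas_multisymplectization: "atlas (multisymplectization M) = lift_chart ` atlas M"
proof -
  have image: "{f c d |c d. c \<in> A \<and> d \<in> {e}} = (\<lambda>c. f c e) ` A"
    for f :: "'x \<Rightarrow> 'y \<Rightarrow> 'z" and A e
    by blast
  have "atlas R_times = {R_chart}" by (simp add: R_times_def)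
  then show ?thesis
    unfolding multisymplectization_def atlas_prod_mfd by (simp only: image fst_conv snd_conv)
qed

text \<open>Since \<open>\<real>\<^sub>\<times>\<close> has a single chart, charts around \<open>(p, z)\<close> come from charts around \<open>p\<close>.\<close>

lemma charts_at_multisymplectization:
  "z \<noteq> 0 \<Longrightarrow> charts_at (multisymplectization M) (p, z) = lift_chart ` charts_at M p"
  unfolding charts_at_def atlas_multisymplectization by auto

lemma lift_chart_in_charts_at:
  "c \<in> charts_at M p \<Longrightarrow> z \<noteq> 0 \<Longrightarrow> lift_chart c \<in> charts_at (multisymplectization M) (p, z)"
  unfolding charts_at_multisymplectization by blast

lemma lift_chart_image: "snd (lift_chart c) ` fst (lift_chart c) = (snd c ` fst c) \<times> (UNIV - {0})"
  by (simp add: map_prod_image)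

lemma open_lift_chart_image:
  "smooth_manifold M \<Longrightarrow> c \<in> atlas M \<Longrightarrow> open ((snd c ` fst c) \<times> (UNIV - {0::real}))"
  by (intro open_Times open_chart_image) (auto simp: open_delete)

lemma chart_inv_lift_chart:
  "smooth_manifold M \<Longrightarrow> c \<in> atlas M \<Longrightarrow> x \<in> snd c ` fst c \<Longrightarrow> z \<noteq> 0 \<Longrightarrow>
    chart_inv (lift_chart c) (x, z) = (chart_inv c x, z)"
  using chart_inv_prod_chart[of c R_chart x z] chart_inj_on[of M c] chart_inv_R_chart[of z] by auto

lemma coord_change_lift_chart:
  assumes M: "smooth_manifold M" and c: "c \<in> charts_at M p" "c' \<in> charts_at M p" and z: "z \<noteq> 0"
  shows "coord_change (lift_chart c) (lift_chart c') (p, z) w = (coord_change c c' p (fst w), snd w)"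
proof -
  note a = charts_atD(1)[OF c(1)]
  have D: "((\<lambda>w. (transition c c' (fst w), snd w)) has_derivative
      (\<lambda>w. (coord_change c c' p (fst w), snd w))) (at (snd c p, z))"
    using has_derivative_compose[OF has_derivative_fst[OF has_derivative_ident],
        of "transition c c'" "coord_change c c' p" "(snd c p, z)" UNIV]
      coord_change_has_derivative[OF M c]
    by (intro has_derivative_Pair has_derivative_snd has_derivative_ident) simp_all
  have "(transition (lift_chart c) (lift_chart c') has_derivative
      (\<lambda>w. (coord_change c c' p (fst w), snd w))) (at (snd c p, z))"
  proof (rule has_derivative_transform_within_open[OF D open_lift_chart_image[OF M a]])
    show "(snd c p, z) \<in> (snd c ` fst c) \<times> (UNIV - {0})"
      using charts_atD(2)[OF c(1)] z by simp
    fix w assume w: "w \<in> (snd c ` fst c) \<times> (UNIV - {0::real})"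
    obtain x r where x: "w = (x, r)" "x \<in> snd c ` fst c" "r \<noteq> 0" using w by blast
    show "(transition c c' (fst w), snd w) = transition (lift_chart c) (lift_chart c') w"
      using chart_inv_lift_chart[OF M a x(2,3)] by (simp add: transition_def x(1))
  qed
  from fun_cong[OF frechet_derivative_at[OF this], of w] show ?thesis by simp
qed

text \<open>In coordinates the projection to \<open>M\<close> drops the last component, whichever lifted chart is
  used; the chart chosen in the definition of \<open>differential\<close> is itself a lifted one.\<close>

lemma differential_fst:
  assumes M: "smooth_manifold M" and c: "c \<in> charts_at M p" and z: "z \<noteq> 0"
    and v: "v \<in> tangent_space (multisymplectization M) (p, z)"
  shows "differential (multisymplectization M) M fst (p, z) v = tvec_of M c p (fst (v (lift_chart c)))"
proof -
  let ?MM = "multisymplectization M"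
  have p: "p \<in> points M" by (rule charts_at_point[OF M c])
  have "chart_at ?MM (p, z) \<in> charts_at ?MM (p, z)"
    by (rule chart_at_in_charts_at[OF smooth_manifold_multisymplectization[OF M]])
      (use p z in \<open>simp add: points_multisymplectization\<close>)
  then obtain c0 where c0: "c0 \<in> charts_at M p" and chart: "chart_at ?MM (p, z) = lift_chart c0"
    unfolding charts_at_multisymplectization[OF z] by blast
  note a = charts_atD(1)[OF c0]
  have coord: "frechet_derivative (snd c' \<circ> fst \<circ> chart_inv (lift_chart c0)) (at (snd c0 p, z)) w =
      coord_change c0 c' p (fst w)" if c': "c' \<in> charts_at M p" for c' w
  proof -
    have D: "((\<lambda>w. transition c0 c' (fst w)) has_derivative (\<lambda>w. coord_change c0 c' p (fst w)))
        (at (snd c0 p, z))"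
      using has_derivative_compose[OF has_derivative_fst[OF has_derivative_ident],
          of "transition c0 c'" "coord_change c0 c' p" "(snd c0 p, z)" UNIV]
        coord_change_has_derivative[OF M c0 c'] by simp
    have "((snd c' \<circ> fst \<circ> chart_inv (lift_chart c0)) has_derivative (\<lambda>w. coord_change c0 c' p (fst w)))
        (at (snd c0 p, z))"
    proof (rule has_derivative_transform_within_open[OF D open_lift_chart_image[OF M a]])
      show "(snd c0 p, z) \<in> (snd c0 ` fst c0) \<times> (UNIV - {0})"
        using charts_atD(2)[OF c0] z by simp
      fix w assume w: "w \<in> (snd c0 ` fst c0) \<times> (UNIV - {0::real})"
      obtain x r where x: "w = (x, r)" "x \<in> snd c0 ` fst c0" "r \<noteq> 0" using w by blast
      show "transition c0 c' (fst w) = (snd c' \<circ> fst \<circ> chart_inv (lift_chart c0)) w"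
        using chart_inv_lift_chart[OF M a x(2,3)] by (simp add: transition_def x(1))
    qed
    from fun_cong[OF frechet_derivative_at[OF this], of w] show ?thesis by simp
  qed
  have "differential ?MM M fst (p, z) v = tvec_of M c0 p (fst (v (lift_chart c0)))"
    by (rule ext) (simp add: differential_def chart tvec_of_def coord)
  also have "\<dots> = tvec_of M c p (coord_change c0 c p (fst (v (lift_chart c0))))"
    by (rule tvec_of_coord_change[OF M c0 c, symmetric])
  also have "coord_change c0 c p (fst (v (lift_chart c0))) = fst (v (lift_chart c))"
    unfolding tangent_coord_change[OF v lift_chart_in_charts_at[OF c0 z] lift_chart_in_charts_at[OF c z]]
    using coord_change_lift_chart[OF M c0 c z] by simp
  finally show ?thesis .
qed

text \<open>The form \<open>z \<theta>\<close> on the image of a lifted chart, where \<open>fst\<close> and \<open>snd\<close> of a point are the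
  coordinates on \<open>M\<close> and \<open>z\<close>.\<close>

definition local_potential ::
  "('e \<Rightarrow> 'e list \<Rightarrow> real) \<Rightarrow> 'e \<times> real \<Rightarrow> ('e \<times> real) list \<Rightarrow> real" where
  "local_potential \<theta> w ws = snd w * \<theta> (fst w) (map fst ws)"

lemma canonical_potential_eq:
  assumes M: "smooth_manifold M" and c: "c \<in> charts_at M p" and z: "z \<noteq> 0"
    and vs: "set vs \<subseteq> tangent_space (multisymplectization M) (p, z)"
  shows "canonical_potential M \<Theta> (p, z) vs =
    local_potential (local_form M \<Theta> c) (snd c p, z) (map (\<lambda>v. v (lift_chart c)) vs)"
proof -
  have "map (differential (multisymplectization M) M fst (p, z)) vs =
      map (tvec_of M c p) (map fst (map (\<lambda>v. v (lift_chart c)) vs))"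
  proof -
    have "differential (multisymplectization M) M fst (p, z) v = tvec_of M c p (fst (v (lift_chart c)))"
      if "v \<in> set vs" for v
      by (rule differential_fst[OF M c z]) (use that vs in blast)
    then show ?thesis by simp
  qed
  moreover have "(p, z) \<in> points (multisymplectization M)"
    using charts_at_point[OF M c] z by (simp add: points_multisymplectization)
  ultimately show ?thesis
    using vs
    by (simp add: canonical_potential_def form_scale_def pullback_def local_potential_def
        local_form_chart[OF M c] del: map_map)
qed

lemma local_form_canonical_potential:
  assumes M: "smooth_manifold M" and c: "c \<in> atlas M"
    and w: "w \<in> snd (lift_chart c) ` fst (lift_chart c)"
  shows "local_form (multisymplectization M) (canonical_potential M \<Theta>) (lift_chart c) w ws =
    local_potential (local_form M \<Theta> c) w ws"
proof -
  obtain p z where w: "w = (snd c p, z)" "p \<in> fst c" "z \<noteq> 0"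
    using w unfolding lift_chart_image by auto
  have cp: "c \<in> charts_at M p" by (rule charts_atI[OF c w(2)])
  note MM = smooth_manifold_multisymplectization[OF M]
  note C = lift_chart_in_charts_at[OF cp w(3)]
  have "set (map (tvec_of (multisymplectization M) (lift_chart c) (p, z)) ws) \<subseteq>
      tangent_space (multisymplectization M) (p, z)"
    using tvec_of_in_tangent_space[OF MM C] by auto
  from canonical_potential_eq[OF M cp w(3) this]
  show ?thesis
    using local_form_chart[OF MM C, of "canonical_potential M \<Theta>" ws] map_coord_tvec_of[OF MM C, of ws]
    by (simp add: w(1))
qed

lemma alternating_compose_linear:
  assumes "alternating n \<alpha>" "linear L"
  shows "alternating n (\<lambda>ws. c * \<alpha> (map L ws))"
  unfolding alternating_def
proof (intro conjI allI impI)
  show "c * \<alpha> (map L vs) = 0" if "length vs \<noteq> n" for vs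
    using alternating_length[OF assms(1)] that by simp
  show "linear (\<lambda>v. c * \<alpha> (map L (xs @ v # ys)))" for xs ys
  proof -
    have lin: "linear (\<lambda>v. \<alpha> (map L xs @ v # map L ys))" by (rule alternating_linear[OF assms(1)])
    show ?thesis
      by (rule linearI)
        (simp_all add: linear_add[OF assms(2)] linear_scale[OF assms(2)] linear_add[OF lin]
          linear_scale[OF lin] distrib_left)
  qed
  show "c * \<alpha> (map L (xs @ v # ys @ v # zs)) = 0" for xs v ys zs
    using alternating_repeat[OF assms(1), of "map L xs" "L v" "map L ys" "map L zs"] by simp
qed

lemma form_on_local_potential:
  assumes \<theta>: "form_on n S \<theta>" and T: "open T"
  shows "form_on n (S \<times> T) (local_potential \<theta>)"
proof -
  have S: "open S" and alt: "\<And>x. x \<in> S \<Longrightarrow> alternating n (\<theta> x)"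
    and sm: "\<And>ws. smooth_on S (\<lambda>x. \<theta> x ws)"
    using \<theta> unfolding form_on_def by blast+
  note ST = open_Times[OF S T]
  have "alternating n (local_potential \<theta> w)" if "w \<in> S \<times> T" for w
    unfolding local_potential_def
    by (rule alternating_compose_linear[OF alt bounded_linear.linear[OF bounded_linear_fst]])
      (use that in auto)
  moreover have "smooth_on (S \<times> T) (\<lambda>w. local_potential \<theta> w ws)" for ws
    unfolding local_potential_def
    by (intro smooth_on_mult ST smooth_on_bounded_linear[OF bounded_linear_snd]
        smooth_on_compose_linear_right[OF bounded_linear_fst ST _ sm]) auto
  ultimately show ?thesis using ST unfolding form_on_def by blast
qed

text \<open>In a chart, \<open>d(z \<theta>) = dz \<and> \<theta> + z d\<theta>\<close>.\<close>

lemma local_d_local_potential: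
  assumes \<theta>: "form_on n S \<theta>" and x: "x \<in> S"
  shows "local_d (local_potential \<theta>) (x, z) ws =
    skew_sum (\<lambda>u vs. snd u * \<theta> x (map fst vs)) ws + z * local_d \<theta> x (map fst ws)"
proof -
  have "frechet_derivative (\<lambda>w. local_potential \<theta> w vs) (at (x, z)) =
      (\<lambda>u. z * frechet_derivative (\<lambda>y. \<theta> y (map fst vs)) (at x) (fst u) + snd u * \<theta> x (map fst vs))"
    for vs
  proof (rule frechet_derivative_at[symmetric])
    have "((\<lambda>w. \<theta> (fst w) (map fst vs)) has_derivative
        (\<lambda>u. frechet_derivative (\<lambda>y. \<theta> y (map fst vs)) (at x) (fst u))) (at (x, z))"
      using has_derivative_compose[OF has_derivative_fst[OF has_derivative_ident],
          of "\<lambda>y. \<theta> y (map fst vs)" "frechet_derivative (\<lambda>y. \<theta> y (map fst vs)) (at x)" "(x, z)" UNIV]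
        form_on_has_derivative[OF \<theta> x] by simp
    from has_derivative_mult[OF has_derivative_snd[OF has_derivative_ident] this]
    show "((\<lambda>w. local_potential \<theta> w vs) has_derivative
      (\<lambda>u. z * frechet_derivative (\<lambda>y. \<theta> y (map fst vs)) (at x) (fst u) + snd u * \<theta> x (map fst vs)))
      (at (x, z))"
      unfolding local_potential_def by simp
  qed
  then show ?thesis
    by (simp add: local_d_def skew_sum_add skew_sum_scale skew_sum_map)
qed

lemma diff_form_canonical_potential:
  assumes M: "smooth_manifold M" and \<Theta>: "diff_form n M \<Theta>"
  shows "diff_form n (multisymplectization M) (canonical_potential M \<Theta>)"
proof (rule diff_formI[OF smooth_manifold_multisymplectization[OF M]])
  fix q and vs :: "('a \<times> real, 'b \<times> real) tvec list"
  assume "\<not> (q \<in> points (multisymplectization M) \<and> length vs = n \<and>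
    set vs \<subseteq> tangent_space (multisymplectization M) q)"
  then show "canonical_potential M \<Theta> q vs = 0"
    using diff_form_zero[OF \<Theta>, of "fst q" "map (differential (multisymplectization M) M fst q) vs"]
    by (auto simp: canonical_potential_def form_scale_def pullback_def)
next
  fix C assume "C \<in> atlas (multisymplectization M)"
  then obtain c where C: "C = lift_chart c" and c: "c \<in> atlas M"
    unfolding atlas_multisymplectization by blast
  have "form_on n ((snd c ` fst c) \<times> (UNIV - {0})) (local_potential (local_form M \<Theta> c))"
    by (rule form_on_local_potential[OF form_on_local_form[OF M \<Theta> c]]) (simp add: open_delete)
  then show "form_on n (snd C ` fst C) (local_form (multisymplectization M) (canonical_potential M \<Theta>) C)"
    unfolding C lift_chart_image[symmetric]
    by (rule form_on_cong) (rule local_form_canonical_potential[OF M c, symmetric])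
qed

lemma ext_deriv_canonical_potential:
  assumes M: "smooth_manifold M" and \<Theta>: "diff_form n M \<Theta>" and c: "c \<in> charts_at M p"
    and z: "z \<noteq> 0" and vs: "set vs \<subseteq> tangent_space (multisymplectization M) (p, z)"
  shows "ext_deriv (multisymplectization M) (canonical_potential M \<Theta>) (p, z) vs =
    local_d (local_potential (local_form M \<Theta> c)) (snd c p, z) (map (\<lambda>v. v (lift_chart c)) vs)"
proof -
  note MM = smooth_manifold_multisymplectization[OF M]
  note a = charts_atD(1)[OF c]
  have "ext_deriv (multisymplectization M) (canonical_potential M \<Theta>) (p, z) vs =
    local_d (local_form (multisymplectization M) (canonical_potential M \<Theta>) (lift_chart c))
      (snd (lift_chart c) (p, z)) (map (\<lambda>v. v (lift_chart c)) vs)"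
    by (rule ext_deriv_local[OF MM diff_form_canonical_potential[OF M \<Theta>] lift_chart_in_charts_at[OF c z] vs])
  also have "local_d (local_form (multisymplectization M) (canonical_potential M \<Theta>) (lift_chart c))
      (snd (lift_chart c) (p, z)) = local_d (local_potential (local_form M \<Theta> c)) (snd (lift_chart c) (p, z))"
  proof (rule local_d_cong)
    show "open (snd (lift_chart c) ` fst (lift_chart c))"
      unfolding lift_chart_image by (rule open_lift_chart_image[OF M a])
    show "snd (lift_chart c) (p, z) \<in> snd (lift_chart c) ` fst (lift_chart c)"
      using charts_atD(2)[OF c] z by (intro imageI) simp
  qed (rule local_form_canonical_potential[OF M a])
  finally show ?thesis by simp
qed

section \<open>The kernel of \<open>dz \<and> \<theta> + z d\<theta>\<close>\<close>

text \<open>\<open>dz\<close> vanishes on vectors tangent to \<open>M\<close>.\<close>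

lemma skew_sum_horizontal:
  "skew_sum (\<lambda>u vs. snd u * \<beta> vs) (map (\<lambda>w. (w, 0)) us) = (0::real)"
  by (simp add: skew_sum_map)

text \<open>Here \<open>skew_sum (\<lambda>u vs. snd u * \<alpha> (map fst vs))\<close> is \<open>dz \<and> \<alpha>\<close>, and \<open>\<alpha>\<close>, \<open>\<delta>\<close> are the values of \<open>\<Theta>\<close>,
  \<open>d\<Theta>\<close> at a point. Evaluating the contraction with \<open>(a, t)\<close> on vectors tangent to \<open>M\<close> gives
  \<open>t \<alpha> + z \<iota>\<^sub>a\<delta> = 0\<close>; putting \<open>\<partial>/\<partial>z\<close> in front of them gives \<open>\<iota>\<^sub>a\<alpha> = 0\<close>.\<close>

lemma first_kernel_potential:
  fixes \<alpha> \<delta> :: "'e::real_vector list \<Rightarrow> real"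
  assumes \<alpha>: "alternating n \<alpha>" and \<delta>: "alternating (Suc n) \<delta>" and z: "z \<noteq> 0"
    and nontrivial: "first_kernel \<delta> \<noteq> {0}"
  shows "first_kernel (\<lambda>ws. skew_sum (\<lambda>u vs. snd u * \<alpha> (map fst vs)) ws + z * \<delta> (map fst ws)) = {0} \<longleftrightarrow>
    first_kernel \<alpha> \<inter> first_kernel \<delta> = {0}"
proof -
  define \<Omega> where "\<Omega> ws = skew_sum (\<lambda>u vs. snd u * \<alpha> (map fst vs)) ws + z * \<delta> (map fst ws)" for ws
  have \<Omega>: "\<Omega> ((a, t) # ws) = t * \<alpha> (map fst ws) -
      skew_sum (\<lambda>u vs. snd u * \<alpha> (a # map fst vs)) ws + z * \<delta> (a # map fst ws)" for a t ws
    by (simp add: \<Omega>_def skew_sum_Cons)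
  have \<alpha>0: "\<alpha> (0 # ws) = 0" for ws
    using linear_0[OF alternating_linear[OF \<alpha>, of "[]" ws]] by simp
  have \<delta>0: "\<delta> (us @ 0 # ws) = 0" for us ws
    using linear_0[OF alternating_linear[OF \<delta>, of us ws]] by simp
  have \<delta>0': "\<delta> (0 # ws) = 0" for ws using \<delta>0[of "[]" ws] by simp
  have zero: "0 \<in> first_kernel \<alpha>" "0 \<in> first_kernel \<delta>" "0 \<in> first_kernel \<Omega>"
    by (simp_all add: first_kernel_def \<alpha>0 \<delta>0' \<Omega> zero_prod_def)
  have "first_kernel \<Omega> = {0} \<longleftrightarrow> first_kernel \<alpha> \<inter> first_kernel \<delta> = {0}"
  proof
    assume ker: "first_kernel \<Omega> = {0}"
    have "a = 0" if "a \<in> first_kernel \<alpha> \<inter> first_kernel \<delta>" for a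
    proof -
      have "(a, 0) \<in> first_kernel \<Omega>"
        using that by (simp add: first_kernel_def \<Omega>)
      then show ?thesis unfolding ker by (simp add: zero_prod_def)
    qed
    then show "first_kernel \<alpha> \<inter> first_kernel \<delta> = {0}" using zero by blast
  next
    assume ker: "first_kernel \<alpha> \<inter> first_kernel \<delta> = {0}"
    have "a = 0 \<and> t = 0" if "(a, t) \<in> first_kernel \<Omega>" for a t
    proof -
      have \<Omega>0: "\<Omega> ((a, t) # ws) = 0" for ws
        using that by (simp add: first_kernel_def)
      have horizontal: "t * \<alpha> us + z * \<delta> (a # us) = 0" for us
        using \<Omega>0[of "map (\<lambda>w. (w, 0)) us"] by (simp add: \<Omega> skew_sum_horizontal o_def)
      have "\<alpha> (a # us) = 0" for us
        using \<Omega>0[of "(0, 1) # map (\<lambda>w. (w, 0)) us"] \<delta>0[of "[a]" us]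
        by (simp add: \<Omega> skew_sum_Cons skew_sum_horizontal o_def \<alpha>0)
      then have a\<alpha>: "a \<in> first_kernel \<alpha>" by (simp add: first_kernel_def)
      obtain b where b: "b \<in> first_kernel \<delta>" "b \<noteq> 0" using nontrivial zero by blast
      \<comment> \<open>\<open>t \<alpha> = - z \<iota>\<^sub>a\<delta>\<close> makes the kernel of \<open>\<delta>\<close> a subspace of the kernel of \<open>\<alpha>\<close> unless \<open>t = 0\<close>.\<close>
      have "t = 0"
      proof (rule ccontr)
        assume "t \<noteq> 0"
        have "\<alpha> (b # us) = 0" for us
        proof -
          have "\<delta> (a # b # us) = - \<delta> (b # a # us)"
            using alternating_swap[OF \<delta>, of "[]" a b us] by simp
          also have "\<dots> = 0" using b(1) by (simp add: first_kernel_def)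
          finally show ?thesis using horizontal[of "b # us"] \<open>t \<noteq> 0\<close> by simp
        qed
        then have "b \<in> first_kernel \<alpha> \<inter> first_kernel \<delta>" using b(1) by (simp add: first_kernel_def)
        then show False using b(2) unfolding ker by simp
      qed
      then have "a \<in> first_kernel \<delta>" using horizontal z by (simp add: first_kernel_def)
      then have "a \<in> {0}" using a\<alpha> unfolding ker[symmetric] by blast
      then show ?thesis using \<open>t = 0\<close> by simp
    qed
    then have "first_kernel \<Omega> \<subseteq> {0}" by (auto simp: zero_prod_def)
    then show "first_kernel \<Omega> = {0}" using zero(3) by blast
  qed
  then show ?thesis unfolding \<Omega>_def .
qed

section \<open>Non-degeneracy and the Liouville vector field\<close>

lemma ker1_multisymplectization:
  assumes M: "smooth_manifold M" and \<Theta>: "diff_form n M \<Theta>" and p: "p \<in> points M" and z: "z \<noteq> 0"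
    and nontrivial: "ker1 M (ext_deriv M \<Theta>) p \<noteq> {tzero}"
  shows "ker1 (multisymplectization M)
      (form_uminus (ext_deriv (multisymplectization M) (canonical_potential M \<Theta>))) (p, z) = {tzero} \<longleftrightarrow>
    ker1 M \<Theta> p \<inter> ker1 M (ext_deriv M \<Theta>) p = {tzero}"
proof -
  let ?MM = "multisymplectization M"
  let ?\<Omega> = "form_uminus (ext_deriv ?MM (canonical_potential M \<Theta>))"
  note MM = smooth_manifold_multisymplectization[OF M]
  define c where "c = chart_at M p"
  have c: "c \<in> charts_at M p" unfolding c_def by (rule chart_at_in_charts_at[OF M p])
  have x: "snd c p \<in> snd c ` fst c" using charts_atD(2)[OF c] by (rule imageI)
  note C = lift_chart_in_charts_at[OF c z]
  note \<theta> = form_on_local_form[OF M \<Theta> charts_atD(1)[OF c]]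
  have \<Omega>: "diff_form (Suc n) ?MM ?\<Omega>"
    by (intro diff_form_uminus[OF MM] diff_form_ext_deriv[OF MM] diff_form_canonical_potential[OF M \<Theta>])
  define \<alpha> where "\<alpha> = local_form M \<Theta> c (snd c p)"
  define \<delta> where "\<delta> = local_form M (ext_deriv M \<Theta>) c (snd c p)"
  have \<delta>_eq: "\<delta> ws = local_d (local_form M \<Theta> c) (snd c p) ws" for ws
    unfolding \<delta>_def by (rule local_form_ext_deriv[OF M \<Theta> charts_atD(1)[OF c] x])
  have \<alpha>: "alternating n \<alpha>" unfolding \<alpha>_def by (rule alternating_local_form[OF M \<Theta> c])
  have \<delta>: "alternating (Suc n) \<delta>"
    unfolding \<delta>_def by (rule alternating_local_form[OF M diff_form_ext_deriv[OF M \<Theta>] c])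
  have \<Omega>_eq: "local_form ?MM ?\<Omega> (lift_chart c) (snd (lift_chart c) (p, z)) ws =
      - (skew_sum (\<lambda>u vs. snd u * \<alpha> (map fst vs)) ws + z * \<delta> (map fst ws))" for ws
  proof -
    have "set (map (tvec_of ?MM (lift_chart c) (p, z)) ws) \<subseteq> tangent_space ?MM (p, z)"
      using tvec_of_in_tangent_space[OF MM C] by auto
    from ext_deriv_canonical_potential[OF M \<Theta> c z this]
    show ?thesis
      unfolding local_form_chart[OF MM C] map_coord_tvec_of[OF MM C] local_d_local_potential[OF \<theta> x]
      by (simp add: form_uminus_def \<alpha>_def \<delta>_eq)
  qed
  have ker_\<delta>: "ker1 M (ext_deriv M \<Theta>) p = {v \<in> tangent_space M p. v c \<in> first_kernel \<delta>}"
    unfolding \<delta>_def by (rule ker1_local[OF M diff_form_ext_deriv[OF M \<Theta>] c])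
  have ker_\<alpha>: "ker1 M \<Theta> p = {v \<in> tangent_space M p. v c \<in> first_kernel \<alpha>}"
    unfolding \<alpha>_def by (rule ker1_local[OF M \<Theta> c])
  have "first_kernel \<delta> \<noteq> {0}"
    using nontrivial unfolding ker_\<delta> tangent_subspace_trivial_iff[OF M c] .
  note algebra = first_kernel_potential[OF \<alpha> \<delta> z this]
  have "ker1 ?MM ?\<Omega> (p, z) = {tzero} \<longleftrightarrow>
      first_kernel (local_form ?MM ?\<Omega> (lift_chart c) (snd (lift_chart c) (p, z))) = {0}"
    unfolding ker1_local[OF MM \<Omega> C] by (rule tangent_subspace_trivial_iff[OF MM C])
  also have "first_kernel (local_form ?MM ?\<Omega> (lift_chart c) (snd (lift_chart c) (p, z))) =
      first_kernel (\<lambda>ws. skew_sum (\<lambda>u vs. snd u * \<alpha> (map fst vs)) ws + z * \<delta> (map fst ws))"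
    unfolding first_kernel_def \<Omega>_eq neg_equal_0_iff_equal by (rule refl)
  also have "\<dots> = {0} \<longleftrightarrow> first_kernel \<alpha> \<inter> first_kernel \<delta> = {0}"
    by (rule algebra)
  also have "\<dots> \<longleftrightarrow> {v \<in> tangent_space M p. v c \<in> first_kernel \<alpha> \<inter> first_kernel \<delta>} = {tzero}"
    by (rule tangent_subspace_trivial_iff[OF M c, symmetric])
  also have "{v \<in> tangent_space M p. v c \<in> first_kernel \<alpha> \<inter> first_kernel \<delta>} =
      ker1 M \<Theta> p \<inter> ker1 M (ext_deriv M \<Theta>) p"
    unfolding ker_\<alpha> ker_\<delta> by blast
  finally show ?thesis .
qed

text \<open>The vector field \<open>z \<partial>/\<partial>z\<close>.\<close>

definition liouville :: "('a, 'e::euclidean_space) mfd \<Rightarrow> 'a \<times> real \<Rightarrow> ('a \<times> real, 'e \<times> real) tvec" where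
  "liouville M q = (\<lambda>C. if C \<in> charts_at (multisymplectization M) q then (0, snd q) else 0)"

lemma liouville_in_tangent_space:
  assumes M: "smooth_manifold M" and z: "z \<noteq> 0"
  shows "liouville M (p, z) \<in> tangent_space (multisymplectization M) (p, z)"
  unfolding tangent_space_def mem_Collect_eq
proof (intro conjI allI impI ballI)
  show "liouville M (p, z) C = 0" if "C \<notin> charts_at (multisymplectization M) (p, z)" for C
    using that by (simp add: liouville_def)
next
  fix C C'
  assume C: "C \<in> charts_at (multisymplectization M) (p, z)"
    and C': "C' \<in> charts_at (multisymplectization M) (p, z)"
  obtain c where c: "C = lift_chart c" "c \<in> charts_at M p"
    using C unfolding charts_at_multisymplectization[OF z] by blast
  obtain c' where c': "C' = lift_chart c'" "c' \<in> charts_at M p"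
    using C' unfolding charts_at_multisymplectization[OF z] by blast
  have "coord_change C C' (p, z) (0, z) = (0, z)"
    unfolding c(1) c'(1)
    using coord_change_lift_chart[OF M c(2) c'(2) z, of "(0, z)"] linear_0[OF coord_change_linear[OF M c(2) c'(2)]]
    by simp
  then show "liouville M (p, z) C' = coord_change C C' (p, z) (liouville M (p, z) C)"
    using C C' by (simp add: liouville_def)
qed

lemma vector_field_liouville:
  assumes M: "smooth_manifold M"
  shows "vector_field (multisymplectization M) (liouville M)"
  unfolding vector_field_def
proof (intro conjI ballI)
  fix q assume "q \<in> points (multisymplectization M)"
  then obtain p z where "q = (p, z)" "z \<noteq> 0" unfolding points_multisymplectization by blast
  then show "liouville M q \<in> tangent_space (multisymplectization M) q"
    using liouville_in_tangent_space[OF M] by simp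
next
  fix C assume "C \<in> atlas (multisymplectization M)"
  then obtain c where C: "C = lift_chart c" and c: "c \<in> atlas M"
    unfolding atlas_multisymplectization by blast
  have eq: "(0, snd w) = liouville M (chart_inv C w) C" if w: "w \<in> (snd c ` fst c) \<times> (UNIV - {0})" for w
  proof -
    obtain x r where x: "w = (x, r)" "x \<in> snd c ` fst c" "r \<noteq> 0" using w by blast
    have "c \<in> charts_at M (chart_inv c x)" by (rule charts_atI[OF c chart_inv_in[OF x(2)]])
    then show ?thesis
      using lift_chart_in_charts_at[of c M "chart_inv c x" r] chart_inv_lift_chart[OF M c x(2,3)] x(3)
      by (simp add: liouville_def C x(1))
  qed
  have "smooth_on ((snd c ` fst c) \<times> (UNIV - {0::real})) (\<lambda>w. (0, snd w))"
    by (intro smooth_on_Pair open_lift_chart_image[OF M c] smooth_on_const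
        smooth_on_bounded_linear[OF bounded_linear_snd])
  then have "smooth_on ((snd c ` fst c) \<times> (UNIV - {0})) (\<lambda>w. liouville M (chart_inv C w) C)"
    by (rule iffD1[OF smooth_on_cong[OF open_lift_chart_image[OF M c]], rotated]) (rule eq)
  moreover have "snd C ` fst C = (snd c ` fst c) \<times> (UNIV - {0})"
    unfolding C by (rule lift_chart_image)
  ultimately show "smooth_on (snd C ` fst C) (\<lambda>w. liouville M (chart_inv C w) C)" by simp
qed

text \<open>In \<open>dz \<and> \<theta> + z d\<theta>\<close>, only the first term of \<open>dz \<and> \<theta>\<close> survives the insertion of \<open>(0, z)\<close>,
  because its component along \<open>M\<close> is zero.\<close>

lemma int_prod_liouville:
  assumes M: "smooth_manifold M" and \<Theta>: "diff_form n M \<Theta>"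
  shows "(\<lambda>q. int_prod (liouville M q)
      (form_uminus (ext_deriv (multisymplectization M) (canonical_potential M \<Theta>)) q)) =
    form_uminus (canonical_potential M \<Theta>)"
proof (intro ext)
  fix q and vs :: "('a \<times> real, 'b \<times> real) tvec list"
  let ?MM = "multisymplectization M"
  have "ext_deriv ?MM (canonical_potential M \<Theta>) q (liouville M q # vs) = canonical_potential M \<Theta> q vs"
  proof (cases "q \<in> points ?MM \<and> set vs \<subseteq> tangent_space ?MM q")
    case False
    then show ?thesis
      by (auto simp: ext_deriv_def canonical_potential_def form_scale_def pullback_def)
  next
    case True
    then obtain p z where q: "q = (p, z)" "p \<in> points M" "z \<noteq> 0"
      unfolding points_multisymplectization by blast
    have vs: "set vs \<subseteq> tangent_space ?MM (p, z)" using True q(1) by simp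
    define c where "c = chart_at M p"
    have c: "c \<in> charts_at M p" unfolding c_def by (rule chart_at_in_charts_at[OF M q(2)])
    have x: "snd c p \<in> snd c ` fst c" using charts_atD(2)[OF c] by (rule imageI)
    note \<theta> = form_on_local_form[OF M \<Theta> charts_atD(1)[OF c]]
    define \<alpha> where "\<alpha> = local_form M \<Theta> c (snd c p)"
    define ws where "ws = map (\<lambda>v. v (lift_chart c)) vs"
    have \<alpha>0: "\<alpha> (0 # us) = 0" for us
      using linear_0[OF alternating_linear[OF alternating_local_form[OF M \<Theta> c], of "[]" us]]
      by (simp add: \<alpha>_def)
    have \<delta>0: "local_d (local_form M \<Theta> c) (snd c p) (0 # us) = 0" for us
    proof -
      have "alternating (Suc n) (local_d (local_form M \<Theta> c) (snd c p))"
        using form_on_local_d[OF \<theta>] x unfolding form_on_def by blast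
      from linear_0[OF alternating_linear[OF this, of "[]" us]] show ?thesis by simp
    qed
    have coord: "liouville M (p, z) (lift_chart c) = (0, z)"
      using lift_chart_in_charts_at[OF c q(3)] by (simp add: liouville_def)
    have tangent: "set (liouville M (p, z) # vs) \<subseteq> tangent_space ?MM (p, z)"
      using vs liouville_in_tangent_space[OF M q(3)] by simp
    have "ext_deriv ?MM (canonical_potential M \<Theta>) (p, z) (liouville M (p, z) # vs) =
        local_d (local_potential (local_form M \<Theta> c)) (snd c p, z) ((0, z) # ws)"
      unfolding ext_deriv_canonical_potential[OF M \<Theta> c q(3) tangent] by (simp add: coord ws_def)
    also have "\<dots> = z * \<alpha> (map fst ws)"
      unfolding local_d_local_potential[OF \<theta> x] \<alpha>_def[symmetric]
      by (simp add: skew_sum_Cons \<alpha>0 \<delta>0)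
    also have "\<dots> = canonical_potential M \<Theta> (p, z) vs"
      unfolding canonical_potential_eq[OF M c q(3) vs] by (simp add: local_potential_def \<alpha>_def ws_def)
    finally show ?thesis unfolding q(1) .
  qed
  then show "int_prod (liouville M q) (form_uminus (ext_deriv ?MM (canonical_potential M \<Theta>)) q) vs =
      form_uminus (canonical_potential M \<Theta>) q vs"
    by (simp add: int_prod_def form_uminus_def)
qed

theorem proposition3p7:
  fixes M :: "('a, 'e::euclidean_space) mfd" and \<Theta> :: "('a, 'e) form" and n :: nat
  assumes "smooth_manifold M"
    and "diff_form n M \<Theta>"
    and "\<forall>p\<in>points M. ker1 M (ext_deriv M \<Theta>) p \<noteq> {tzero}"
  shows "homogeneous_multisymplectic n (multisymplectization M) (canonical_potential M \<Theta>) \<longleftrightarrow>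
    (\<forall>p\<in>points M. ker1 M \<Theta> p \<inter> ker1 M (ext_deriv M \<Theta>) p = {tzero})"
proof -
  let ?MM = "multisymplectization M" and ?\<Upsilon> = "canonical_potential M \<Theta>"
  let ?\<Omega> = "form_uminus (ext_deriv ?MM ?\<Upsilon>)"
  note MM = smooth_manifold_multisymplectization[OF assms(1)]
  have \<Upsilon>: "diff_form n ?MM ?\<Upsilon>" by (rule diff_form_canonical_potential[OF assms(1,2)])
  have d\<Upsilon>: "diff_form (Suc n) ?MM (ext_deriv ?MM ?\<Upsilon>)" by (rule diff_form_ext_deriv[OF MM \<Upsilon>])
  have \<Omega>: "diff_form (Suc n) ?MM ?\<Omega>" by (rule diff_form_uminus[OF MM d\<Upsilon>])
  have "ext_deriv ?MM ?\<Omega> = form_zero"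
    unfolding ext_deriv_uminus[OF MM d\<Upsilon>] ext_deriv_ext_deriv[OF MM \<Upsilon>]
    by (simp add: form_uminus_def form_zero_def)
  then have pre: "pre_multisymplectic n ?MM ?\<Omega>"
    unfolding pre_multisymplectic_def using MM \<Omega> by blast
  have liouville: "\<exists>\<Delta>. vector_field ?MM \<Delta> \<and> (\<lambda>q. int_prod (\<Delta> q) (?\<Omega> q)) = form_uminus ?\<Upsilon>"
    using vector_field_liouville[OF assms(1)] int_prod_liouville[OF assms(1,2)] by blast
  have "homogeneous_multisymplectic n ?MM ?\<Upsilon> \<longleftrightarrow>
      (\<forall>q\<in>points ?MM. inj_on (\<lambda>v. int_prod v (?\<Omega> q)) (tangent_space ?MM q))"
    unfolding homogeneous_multisymplectic_def multisymplectic_def using \<Upsilon> pre liouville by blast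
  also have "\<dots> \<longleftrightarrow> (\<forall>q\<in>points ?MM. ker1 ?MM ?\<Omega> q = {tzero})"
    by (intro ball_cong refl inj_on_int_prod_iff[OF MM \<Omega>])
  also have "\<dots> \<longleftrightarrow> (\<forall>p\<in>points M. \<forall>z\<in>UNIV - {0}. ker1 ?MM ?\<Omega> (p, z) = {tzero})"
    unfolding points_multisymplectization by blast
  also have "\<dots> \<longleftrightarrow> (\<forall>p\<in>points M. \<forall>z\<in>UNIV - {0::real}.
      ker1 M \<Theta> p \<inter> ker1 M (ext_deriv M \<Theta>) p = {tzero})"
    by (intro ball_cong refl ker1_multisymplectization[OF assms(1,2)]) (use assms(3) in auto)
  \<comment> \<open>The condition does not depend on \<open>z\<close>, and the fibre \<open>\<real>\<^sub>\<times>\<close> is not empty.\<close>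
  also have "\<dots> \<longleftrightarrow> (\<forall>p\<in>points M. ker1 M \<Theta> p \<inter> ker1 M (ext_deriv M \<Theta>) p = {tzero})"
    using zero_neq_one by blast
  finally show ?thesis .
qed

end
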